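(* Let $m>1$, $D>0$ and $r\ge 0$, and let $b,d$ satisfy the standing assumptions below. Let $c_0>0$ and the sharp wave solutions $\phi$ of speed $c_0$ be those given by the following existence result: there exists $c_0=c_0(m,r,b,d)>0$ such that the wave profile equation $$c\phi'(t)=D(\phi^m)''(t)-d(\phi(t))+b(\phi(t-cr)),\qquad t\in\mathbb R,$$ with $c=c_0$ admits a sharp wave solution $\phi$ with $\phi\equiv0$ on $(-\infty,0]$, $\phi>0$ on $(0,\infty)$, $\zeta_1\le\liminf_{t\to+\infty}\phi\le\limsup_{t\to+\infty}\phi\le\zeta_2$, and $|\phi(t)-C_1t^{1/(m-1)}|\le C_2t^{\Lambda}$ on $(0,1)$ for some $\Lambda>1/(m-1)$, $C_1,C_2>0$. Then: if $m\ge2$, these sharp waves are of non-$C^1$ type; if $1<m<2$, these sharp waves are of $C^1$ type.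
   Context: Standing assumptions: the death rate $d\in C^2([0,+\infty))$ satisfies $d(0)=0$, $d'(s)>0$ and $d''(s)\ge0$ for $s>0$. The birth rate $b\in C^1([0,+\infty);[0,+\infty))$ has exactly one positive local extremum point $s_M$, which is its global maximum point; $b(0)=0$; there is $\kappa>0$ with $b(\kappa)=d(\kappa)$; $b'(0)>d'(0)$; $b'(\kappa)<d'(\kappa)$; and $d(s)<b(s)\le b'(0)s$ for $s\in(0,\kappa)$. Moreover $s_M<\kappa$. Set $M:=b(s_M)$, $\zeta_2:=d^{-1}(M)$, $\theta:=b(\zeta_2)$, and let $\zeta_1\in(0,s_M)$ be the unique point with $b(\zeta_1)=\theta$. Definitions: a function $0\le\phi\in W^{1,1}_{\rm loc}(\mathbb R)\cap L^\infty(\mathbb R)$ with $\phi^m\in W^{1,1}_{\rm loc}(\mathbb R)$ is a semi-wavefront (of speed $c>0$) if (i) it satisfies the wave profile equation in the sense of distributions; (ii) $\phi(-\infty)=0$ and $0<\liminf_{t\to+\infty}\phi\le\limsup_{t\to+\infty}\phi<+\infty$; (iii) there is a maximal interval $(-\infty,t_0)$, $t_0\in(-\infty,+\infty]$, on which $\phi$ is monotonically increasing, and if $t_0<+\infty$ then $\phi(t_0)>\kappa$. A wavefront is a semi-wavefront with $\phi(+\infty)=\kappa$; a wave solution is either. It is sharp if there is $t_*$ with $\phi=0$ on $(-\infty,t_*]$ and $\phi>0$ on $(t_*,\infty)$. A sharp wave is of non-$C^1$ type if $\phi''\notin L^1_{\rm loc}(\mathbb R)$ and of $C^1$ type if $\phi''\in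 L^1_{\rm loc}(\mathbb R)$. *)

theory Defs
  imports "HOL-Analysis.Analysis"
begin

definition test_fun :: "(real \<Rightarrow> real) \<Rightarrow> bool" where
  "test_fun \<psi> \<longleftrightarrow>
     (\<forall>k::nat. \<forall>x. ((deriv ^^ k) \<psi>) differentiable (at x)) \<and>
     (\<exists>a b. \<forall>x. x \<notin> {a..b} \<longrightarrow> \<psi> x = 0)"

definition loc_int :: "(real \<Rightarrow> real) \<Rightarrow> bool" where
  "loc_int f \<longleftrightarrow> (\<forall>a b. f absolutely_integrable_on {a..b})"

definition weak_deriv :: "(real \<Rightarrow> real) \<Rightarrow> (real \<Rightarrow> real) \<Rightarrow> bool" where
  "weak_deriv f g \<longleftrightarrow> loc_int g \<and>
     (\<forall>\<psi>. test_fun \<psi> \<longrightarrow>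
        integral UNIV (\<lambda>x. f x * deriv \<psi> x) = - integral UNIV (\<lambda>x. g x * \<psi> x))"

definition W11_loc :: "(real \<Rightarrow> real) \<Rightarrow> bool" where
  "W11_loc f \<longleftrightarrow> loc_int f \<and> (\<exists>g. weak_deriv f g)"

definition L_inf :: "(real \<Rightarrow> real) \<Rightarrow> bool" where
  "L_inf f \<longleftrightarrow> f \<in> borel_measurable lborel \<and> (\<exists>B. AE x in lborel. \<bar>f x\<bar> \<le> B)"

definition second_deriv_L1loc :: "(real \<Rightarrow> real) \<Rightarrow> bool" where
  "second_deriv_L1loc f \<longleftrightarrow> (\<exists>h. loc_int h \<and>
     (\<forall>\<psi>. test_fun \<psi> \<longrightarrow>
        integral UNIV (\<lambda>x. f x * deriv (deriv \<psi>) x) = integral UNIV (\<lambda>x. h x * \<psi> x)))"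

definition wave_eq_distr ::
  "real \<Rightarrow> real \<Rightarrow> real \<Rightarrow> (real \<Rightarrow> real) \<Rightarrow> (real \<Rightarrow> real) \<Rightarrow> real \<Rightarrow> (real \<Rightarrow> real) \<Rightarrow> bool" where
  "wave_eq_distr m D r b d c \<phi> \<longleftrightarrow>
     (\<forall>\<psi>. test_fun \<psi> \<longrightarrow>
        - c * integral UNIV (\<lambda>t. \<phi> t * deriv \<psi> t) =
          D * integral UNIV (\<lambda>t. \<phi> t powr m * deriv (deriv \<psi>) t)
          - integral UNIV (\<lambda>t. d (\<phi> t) * \<psi> t)
          + integral UNIV (\<lambda>t. b (\<phi> (t - c * r)) * \<psi> t))"

definition semi_wavefront ::
  "real \<Rightarrow> real \<Rightarrow> real \<Rightarrow> (real \<Rightarrow> real) \<Rightarrow> (real \<Rightarrow> real) \<Rightarrow> real \<Rightarrow> real \<Rightarrow> (real \<Rightarrow> real) \<Rightarrow> bool" where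
  "semi_wavefront m D r b d \<kappa> c \<phi> \<longleftrightarrow>
     c > 0 \<and> (\<forall>t. 0 \<le> \<phi> t) \<and> W11_loc \<phi> \<and> L_inf \<phi> \<and> W11_loc (\<lambda>t. \<phi> t powr m) \<and>
     wave_eq_distr m D r b d c \<phi> \<and>
     (\<phi> \<longlongrightarrow> 0) at_bot \<and>
     0 < Liminf at_top (\<lambda>t. ereal (\<phi> t)) \<and>
     Liminf at_top (\<lambda>t. ereal (\<phi> t)) \<le> Limsup at_top (\<lambda>t. ereal (\<phi> t)) \<and>
     Limsup at_top (\<lambda>t. ereal (\<phi> t)) < \<infinity> \<and>
     (mono_on UNIV \<phi> \<or>
      (\<exists>t0. mono_on {..<t0} \<phi> \<and> \<not> (\<exists>t1>t0. mono_on {..<t1} \<phi>) \<and> \<phi> t0 > \<kappa>))"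

definition wavefront ::
  "real \<Rightarrow> real \<Rightarrow> real \<Rightarrow> (real \<Rightarrow> real) \<Rightarrow> (real \<Rightarrow> real) \<Rightarrow> real \<Rightarrow> real \<Rightarrow> (real \<Rightarrow> real) \<Rightarrow> bool" where
  "wavefront m D r b d \<kappa> c \<phi> \<longleftrightarrow> semi_wavefront m D r b d \<kappa> c \<phi> \<and> (\<phi> \<longlongrightarrow> \<kappa>) at_top"

definition wave_solution ::
  "real \<Rightarrow> real \<Rightarrow> real \<Rightarrow> (real \<Rightarrow> real) \<Rightarrow> (real \<Rightarrow> real) \<Rightarrow> real \<Rightarrow> real \<Rightarrow> (real \<Rightarrow> real) \<Rightarrow> bool" where
  "wave_solution m D r b d \<kappa> c \<phi> \<longleftrightarrow>
     semi_wavefront m D r b d \<kappa> c \<phi> \<or> wavefront m D r b d \<kappa> c \<phi>"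

definition is_sharp :: "(real \<Rightarrow> real) \<Rightarrow> bool" where
  "is_sharp \<phi> \<longleftrightarrow> (\<exists>ts. (\<forall>t\<le>ts. \<phi> t = 0) \<and> (\<forall>t>ts. \<phi> t > 0))"

definition sharp_wave ::
  "real \<Rightarrow> real \<Rightarrow> real \<Rightarrow> (real \<Rightarrow> real) \<Rightarrow> (real \<Rightarrow> real) \<Rightarrow> real \<Rightarrow> real \<Rightarrow> (real \<Rightarrow> real) \<Rightarrow> bool" where
  "sharp_wave m D r b d \<kappa> c \<phi> \<longleftrightarrow> wave_solution m D r b d \<kappa> c \<phi> \<and> is_sharp \<phi>"

definition sharp_nonC1_type :: "(real \<Rightarrow> real) \<Rightarrow> bool" where
  "sharp_nonC1_type \<phi> \<longleftrightarrow> is_sharp \<phi> \<and> \<not> second_deriv_L1loc \<phi>"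

definition sharp_C1_type :: "(real \<Rightarrow> real) \<Rightarrow> bool" where
  "sharp_C1_type \<phi> \<longleftrightarrow> is_sharp \<phi> \<and> second_deriv_L1loc \<phi>"

definition pos_local_extremum :: "(real \<Rightarrow> real) \<Rightarrow> real \<Rightarrow> bool" where
  "pos_local_extremum b s \<longleftrightarrow> s > 0 \<and>
     (\<exists>e>0. (\<forall>x. 0 \<le> x \<and> \<bar>x - s\<bar> < e \<longrightarrow> b x \<le> b s) \<or>
            (\<forall>x. 0 \<le> x \<and> \<bar>x - s\<bar> < e \<longrightarrow> b s \<le> b x))"

end

theory Submission
  imports Defs "HOL-Computational_Algebra.Polynomial"
begin

text \<open>
  Testing a weak derivative against smooth approximations of trapezoids shows that a locally integrable
  function with locally integrable weak derivative is almost everywhere a primitive of it.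

  If \<open>m \<ge> 2\<close> and \<open>\<phi>''\<close> were locally integrable, then \<open>\<phi>\<close> would agree almost everywhere with a
  \<open>C\<^sup>1\<close> function vanishing on the left half-line, so \<open>\<phi> t = o(t)\<close> at \<open>0\<close>; but
  \<open>\<phi> t \<sim> C\<^sub>1 t powr (1 / (m - 1))\<close> with exponent at most \<open>1\<close>.

  If \<open>m < 2\<close>, the continuous representative \<open>p\<close> of \<open>\<phi>\<close> satisfies \<open>D (p powr m)' = w + c p\<close> with
  \<open>w' = d(p) - b(p(\<cdot> - c r))\<close> and \<open>w 0 = 0\<close>. The sign of \<open>w'\<close> excludes a first positive zero of \<open>p\<close>,
  so \<open>p\<close> is \<open>C\<^sup>2\<close> on the right half-line. Near \<open>0\<close> both \<open>w\<close> and \<open>w'\<close> are bounded by multiples of \<open>p\<close>, whence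
  \<open>p' = O(p powr (2 - m))\<close> and \<open>p'' = O(p powr (1 - m) p' + p powr (2 - m))\<close>, and the right-hand side is integrable.
\<close>

section \<open>Smooth bump and ramp functions\<close>

text \<open>Each order carries an explicit derivative as a witness, instead of an iterate of
  \<open>deriv\<close>, so closure under sums, products and affine substitution follows by induction
  on the order.\<close>

primrec times_differentiable :: "nat \<Rightarrow> (real \<Rightarrow> real) \<Rightarrow> bool" where
  "times_differentiable 0 f \<longleftrightarrow> True"
| "times_differentiable (Suc n) f \<longleftrightarrow>
     (\<exists>f'. (\<forall>x. (f has_real_derivative f' x) (at x)) \<and> times_differentiable n f')"

lemma times_differentiable_pred:
  "times_differentiable (Suc n) f \<Longrightarrow> times_differentiable n f"
proof (induction n arbitrary: f)
  case (Suc n)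
  obtain f' where "\<And>x. (f has_real_derivative f' x) (at x)" "times_differentiable (Suc n) f'"
    using Suc.prems by auto
  with Suc.IH show ?case
    by auto
qed simp

text \<open>Bridge to \<open>test_fun\<close>: uniqueness of derivatives identifies
  \<open>deriv f\<close> with the witness, so the iterates of \<open>deriv\<close> can be peeled off
  one at a time.\<close>

lemma times_differentiable_imp_deriv:
  assumes "times_differentiable (Suc k) f"
  shows "((deriv ^^ k) f) differentiable (at x)"
  using assms
proof (induction k arbitrary: f)
  case 0
  then show ?case
    by (auto simp: real_differentiable_def)
next
  case (Suc k)
  obtain f' where f': "\<And>x. (f has_real_derivative f' x) (at x)" "times_differentiable (Suc k) f'"
    using Suc.prems by auto
  have "deriv f = f'"
    using f'(1) by (auto intro: DERIV_imp_deriv)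
  then show ?case
    using Suc.IH[OF f'(2)] by (simp add: funpow_swap1)
qed

lemma times_differentiable_add:
  "times_differentiable n f \<Longrightarrow> times_differentiable n g \<Longrightarrow> times_differentiable n (\<lambda>x. f x + g x)"
proof (induction n arbitrary: f g)
  case (Suc n)
  obtain f' g' where "\<And>x. (f has_real_derivative f' x) (at x)" "times_differentiable n f'"
    "\<And>x. (g has_real_derivative g' x) (at x)" "times_differentiable n g'"
    using Suc.prems by auto
  with Suc.IH[of f' g'] show ?case
    by (auto intro!: exI[of _ "\<lambda>x. f' x + g' x"] derivative_intros)
qed simp

lemma times_differentiable_mult:
  "times_differentiable n f \<Longrightarrow> times_differentiable n g \<Longrightarrow> times_differentiable n (\<lambda>x. f x * g x)"
proof (induction n arbitrary: f g)
  case (Suc n)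
  obtain f' g' where "\<And>x. (f has_real_derivative f' x) (at x)" "times_differentiable n f'"
    "\<And>x. (g has_real_derivative g' x) (at x)" "times_differentiable n g'"
    using Suc.prems by auto
  moreover have "times_differentiable n f" "times_differentiable n g"
    using Suc.prems times_differentiable_pred by blast+
  ultimately show ?case
    using Suc.IH[of f' g] Suc.IH[of g' f] 
    by (auto intro!: exI[of _ "\<lambda>x. f' x * g x + g' x * f x"] derivative_intros times_differentiable_add)
qed simp

lemma times_differentiable_const: "times_differentiable n (\<lambda>x. a)"
proof (induction n arbitrary: a)
  case (Suc n)
  then show ?case
    by (auto intro!: exI[of _ "\<lambda>x. 0"])
qed simp

lemma times_differentiable_affine:
  "times_differentiable n f \<Longrightarrow> times_differentiable n (\<lambda>x. f (a * x + c))"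
proof (induction n arbitrary: f)
  case (Suc n)
  obtain f' where f': "\<And>x. (f has_real_derivative f' x) (at x)" "times_differentiable n f'"
    using Suc.prems by auto
  have "((\<lambda>x. f (a * x + c)) has_real_derivative f' (a * x + c) * a) (at x)" for x
    by (rule DERIV_chain2[OF f'(1)]) (auto intro!: derivative_eq_intros)
  moreover have "times_differentiable n (\<lambda>x. f' (a * x + c) * a)"
    using Suc.IH[OF f'(2)] times_differentiable_const times_differentiable_mult by blast
  ultimately show ?case
    by (auto intro!: exI[of _ "\<lambda>x. f' (a * x + c) * a"])
qed simp

text \<open>The exponential beats every polynomial. The free exponent \<open>k\<close> absorbs the
  factor \<open>y\<close> that each \<open>pCons\<close> splits off.\<close>

lemma power_poly_div_exp_tendsto_0:
  "((\<lambda>y::real. y ^ k * poly p y / exp y) \<longlongrightarrow> 0) at_top"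
proof (induction p arbitrary: k)
  case (pCons a p)
  have "((\<lambda>y. a * (y ^ k / exp y) + y ^ Suc k * poly p y / exp y) \<longlongrightarrow> a * 0 + 0) at_top"
    by (intro tendsto_intros tendsto_power_div_exp_0 pCons.IH)
  moreover have "a * (y ^ k / exp y) + y ^ Suc k * poly p y / exp y = y ^ k * poly (pCons a p) y / exp y" for y
    by (simp add: algebra_simps add_divide_distrib)
  ultimately show ?case by simp
qed simp

text \<open>A polynomial in 1/x times the classical flat function exp(-1/x). The polynomial
  prefactor makes the family closed under differentiation.\<close>

definition flat_exp :: "real poly \<Rightarrow> real \<Rightarrow> real" where
  "flat_exp p x = (if x > 0 then poly p (1 / x) * exp (- (1 / x)) else 0)"

text \<open>In y = 1/x the chain rule turns p(y) exp(-y) into y^2 (p - p')(y) exp(-y), and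
  \<open>[:0, 0, 1:]\<close> is y^2. At 0 both one-sided difference quotients tend to 0.\<close>

lemma flat_exp_has_derivative:
  "(flat_exp p has_real_derivative flat_exp ([:0, 0, 1:] * (p - pderiv p)) x) (at x)"
proof -
  consider "x < 0" | "x = 0" | "x > 0" by linarith
  then show ?thesis
  proof cases
    case 1
    have "((\<lambda>x. 0) has_real_derivative 0) (at x)" by simp
    then have "(flat_exp p has_real_derivative 0) (at x)"
      by (rule has_field_derivative_transform_within_open[where S = "{..<0}"])
         (use 1 in \<open>auto simp: flat_exp_def\<close>)
    with 1 show ?thesis by (simp add: flat_exp_def)
  next
    case 3
    have "((\<lambda>x. poly p (1 / x) * exp (- (1 / x))) has_real_derivative
        poly ([:0, 0, 1:] * (p - pderiv p)) (1 / x) * exp (- (1 / x))) (at x)"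
    proof -
      have inv: "((\<lambda>x. 1 / x) has_real_derivative - ((1 / x)\<^sup>2)) (at x)"
        using 3 by (auto intro!: derivative_eq_intros simp: power2_eq_square)
      have "((\<lambda>x. poly p (1 / x)) has_real_derivative poly (pderiv p) (1 / x) * - ((1 / x)\<^sup>2)) (at x)"
        by (rule DERIV_chain2[OF poly_DERIV inv])
      moreover have "((\<lambda>x. exp (- (1 / x))) has_real_derivative exp (- (1 / x)) * (1 / x)\<^sup>2) (at x)"
        by (rule DERIV_chain2[OF DERIV_exp]) (use DERIV_minus[OF inv] in simp)
      ultimately have "((\<lambda>x. poly p (1 / x) * exp (- (1 / x))) has_real_derivative
          poly (pderiv p) (1 / x) * - ((1 / x)\<^sup>2) * exp (- (1 / x))
          + exp (- (1 / x)) * (1 / x)\<^sup>2 * poly p (1 / x)) (at x)"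
        by (rule DERIV_mult)
      moreover have "poly (pderiv p) y * - (y\<^sup>2) * z + z * y\<^sup>2 * poly p y =
          poly ([:0, 0, 1:] * (p - pderiv p)) y * z" for y z :: real
        by (simp add: power2_eq_square algebra_simps)
      ultimately show ?thesis by metis
    qed
    then have "(flat_exp p has_real_derivative
        poly ([:0, 0, 1:] * (p - pderiv p)) (1 / x) * exp (- (1 / x))) (at x)"
      by (rule has_field_derivative_transform_within_open[where S = "{0<..}"])
         (use 3 in \<open>auto simp: flat_exp_def\<close>)
    with 3 show ?thesis by (simp add: flat_exp_def)
  next
    case 2
    \<comment> \<open>The power 1 is the factor 1/h of the difference quotient.\<close>
    have "((\<lambda>h. inverse h ^ 1 * poly p (inverse h) / exp (inverse h)) \<longlongrightarrow> 0) (at_right 0)"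
      by (rule filterlim_compose[OF power_poly_div_exp_tendsto_0 filterlim_inverse_at_top_right])
    then have r: "((\<lambda>h. flat_exp p h / h) \<longlongrightarrow> 0) (at_right 0)"
      by (rule Lim_transform_eventually)
         (auto simp: eventually_at_filter flat_exp_def exp_minus field_simps)
    have l: "((\<lambda>h. flat_exp p h / h) \<longlongrightarrow> 0) (at_left 0)"
      by (rule Lim_transform_eventually[OF tendsto_const])
         (auto simp: eventually_at_filter flat_exp_def)
    have "((\<lambda>h. flat_exp p h / h) \<longlongrightarrow> 0) (at 0)"
      using l r filterlim_split_at by blast
    then show ?thesis
      unfolding 2 DERIV_def by (simp add: flat_exp_def)
  qed
qed

lemma times_differentiable_flat_exp: "times_differentiable n (flat_exp p)"
proof (induction n arbitrary: p)
  case (Suc n)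
  then show ?case
    using flat_exp_has_derivative by auto
qed simp

text \<open>The product of a flat exponential and its reflection at 1/2 lives on (0, 1); dividing by
  its positive integral normalises it.\<close>

lemma exists_smooth_bump:
  obtains B :: "real \<Rightarrow> real" where "\<And>n. times_differentiable n B" "\<And>x. B x \<ge> 0"
    "\<And>x. x \<le> 0 \<or> x \<ge> 1 \<Longrightarrow> B x = 0" "integral {0..1} B = 1"
proof -
  define E where "E x = flat_exp 1 x * flat_exp 1 (-1 * x + 1)" for x
  have smooth: "times_differentiable n E" for n
    unfolding E_def by (intro times_differentiable_mult times_differentiable_affine times_differentiable_flat_exp)
  have "isCont (flat_exp 1) x" for x
    using flat_exp_has_derivative DERIV_isCont by blast
  then have contf: "continuous_on UNIV (flat_exp 1)"
    by (simp add: continuous_at_imp_continuous_on)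
  have cont: "continuous_on {0..1} E"
    unfolding E_def
    by (intro continuous_intros continuous_on_compose2[OF contf]) auto
  have nonneg: "E x \<ge> 0" for x
    by (simp add: E_def flat_exp_def)
  have "integral {0..1} E \<noteq> 0"
  proof
    assume "integral {0..1} E = 0"
    then have "\<forall>x\<in>{0..1}. E x = 0"
      using integral_eq_0_iff[of 0 1 E] cont nonneg by (simp)
    then have "E (1/2) = 0" by simp
    then show False by (simp add: E_def flat_exp_def)
  qed
  then have pos: "integral {0..1} E > 0"
    using integral_nonneg[OF integrable_continuous_real[OF cont]] nonneg by (simp add: order_less_le)
  show ?thesis
  proof (rule that[of "\<lambda>x. (1 / integral {0..1} E) * E x"])
    show "times_differentiable n (\<lambda>x. 1 / integral {0..1} E * E x)" for n
      by (intro times_differentiable_mult times_differentiable_const smooth)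
    show "1 / integral {0..1} E * E x \<ge> 0" for x
      using pos nonneg by simp
    show "1 / integral {0..1} E * E x = 0" if "x \<le> 0 \<or> x \<ge> 1" for x
      using that by (auto simp: E_def flat_exp_def)
    show "integral {0..1} (\<lambda>x. 1 / integral {0..1} E * E x) = 1"
      using pos by simp
  qed
qed

lemma primitive_has_real_derivative:
  fixes f :: "real \<Rightarrow> real"
  assumes cont: "continuous_on UNIV f" and G: "\<And>a b. a \<le> b \<Longrightarrow> integral {a..b} f = G b - G a"
  shows "(G has_real_derivative f x) (at x)"
proof -
  have "((\<lambda>u. integral {x-1..u} f) has_real_derivative f x) (at x within {x-1..x+1})"
    by (rule integral_has_real_derivative) (auto intro: continuous_on_subset[OF cont])
  then have "((\<lambda>u. integral {x-1..u} f + G (x-1)) has_real_derivative f x) (at x within {x-1<..<x+1})"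
    by (auto intro!: derivative_eq_intros elim!: DERIV_subset)
  then have "((\<lambda>u. integral {x-1..u} f + G (x-1)) has_real_derivative f x) (at x)"
    by (simp add: at_within_open_NO_MATCH)
  then show ?thesis
    by (rule has_field_derivative_transform_within_open[where S = "{x-1<..<x+1}"]) (auto simp: G)
qed

text \<open>As integrals over reversed intervals are 0, the difference of
  \<open>integral {x0..x} f\<close> and \<open>integral {x..x0} f\<close> is the oriented integral
  from \<open>x0\<close>.\<close>

lemma exists_primitive:
  fixes f :: "real \<Rightarrow> real" and x0 :: real
  assumes int: "\<And>a b. f integrable_on {a..b}"
  obtains G :: "real \<Rightarrow> real" where "\<And>a b. a \<le> b \<Longrightarrow> integral {a..b} f = G b - G a" "G x0 = 0"
proof (rule that[of "\<lambda>x. integral {x0..x} f - integral {x..x0} f"])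
  let ?G = "\<lambda>x. integral {x0..x} f - integral {x..x0} f"
  show "?G x0 = 0" by simp
  show "integral {a..b} f = ?G b - ?G a" if "a \<le> b" for a b
  proof -
    have z: "integral {v..u} f = 0" if "u \<le> v" for u v
      by (cases "u = v") (use that in auto)
    consider "b \<le> x0" | "a \<le> x0" "x0 \<le> b" | "x0 \<le> a" by linarith
    then show ?thesis
    proof cases
      case 1
      then show ?thesis
        using Henstock_Kurzweil_Integration.integral_combine[OF that 1 int] z[of b x0] z[of a x0] that by linarith
    next
      case 2
      then show ?thesis
        using Henstock_Kurzweil_Integration.integral_combine[OF 2 int] z[of x0 b] z[of a x0] by linarith
    next
      case 3
      then show ?thesis
        using Henstock_Kurzweil_Integration.integral_combine[OF 3 that int] z[of x0 b] z[of x0 a] that by linarith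
    qed
  qed
qed

text \<open>Integrating a bump gives a smooth step \<open>S\<close>, and integrating
  \<open>S\<close> gives a smooth version \<open>P\<close> of max 0 x. Rescaled as P(N x) / N it
  converges to max 0 x, the offset \<open>q\<close> becoming q / N.\<close>

lemma exists_smooth_ramp:
  obtains P S :: "real \<Rightarrow> real" and q :: real where "\<And>n. times_differentiable n P"
    "\<And>x. (P has_real_derivative S x) (at x)"
    "\<And>x. x \<le> 0 \<Longrightarrow> P x = 0" "\<And>x. x \<ge> 1 \<Longrightarrow> P x = x + q"
    "\<And>x. x \<le> 0 \<Longrightarrow> S x = 0" "\<And>x. x \<ge> 1 \<Longrightarrow> S x = 1"
    "\<And>x. 0 \<le> S x \<and> S x \<le> 1" "\<And>x. 0 \<le> P x \<and> P x \<le> max 0 x"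
proof -
  obtain B :: "real \<Rightarrow> real" where B: "\<And>n. times_differentiable n B" "\<And>x. B x \<ge> 0"
    "\<And>x. x \<le> 0 \<or> x \<ge> 1 \<Longrightarrow> B x = 0" "integral {0..1} B = 1"
    using exists_smooth_bump by metis
  obtain B' where "\<And>x. (B has_real_derivative B' x) (at x)"
    using B(1)[of 1] by auto
  then have contB: "continuous_on UNIV B"
    by (meson DERIV_isCont continuous_at_imp_continuous_on)
  then have "B integrable_on {a..b}" for a b
    by (meson continuous_on_subset integrable_continuous_real subset_UNIV)
  then obtain S where S: "\<And>a b. a \<le> b \<Longrightarrow> integral {a..b} B = S b - S a" "S 0 = 0"
    using exists_primitive[of B 0] by metis
  have dS: "(S has_real_derivative B x) (at x)" for x
    using primitive_has_real_derivative[OF contB S(1)] .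
  then have contS: "continuous_on UNIV S"
    by (meson DERIV_isCont continuous_at_imp_continuous_on)
  then have "S integrable_on {a..b}" for a b
    by (meson continuous_on_subset integrable_continuous_real subset_UNIV)
  then obtain P where P: "\<And>a b. a \<le> b \<Longrightarrow> integral {a..b} S = P b - P a" "P 0 = 0"
    using exists_primitive[of S 0] by metis
  have dP: "(P has_real_derivative S x) (at x)" for x
    using primitive_has_real_derivative[OF contS P(1)] .
  have smooth: "times_differentiable n P" for n
  proof -
    have "times_differentiable (Suc (Suc n)) P"
      using dP dS B(1) by (simp, blast)
    then show ?thesis
      using times_differentiable_pred by blast
  qed
  have monoS: "S x \<le> S y" if "x \<le> y" for x y
    using DERIV_nonneg_imp_nondecreasing[OF that] dS B(2) by meson
  have S0: "S x = 0" if "x \<le> 0" for x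
  proof -
    have "integral {x..0} B = 0"
      by (rule integral_unique, rule has_integral_is_0) (use B(3) in auto)
    then show ?thesis using S(1)[OF that] S(2) by simp
  qed
  have S1: "S x = 1" if "x \<ge> 1" for x
  proof -
    have "integral {1..x} B = 0"
      by (rule integral_unique, rule has_integral_is_0) (use B(3) in auto)
    then show ?thesis using S(1)[OF that] S(1)[of 0 1] S(2) B(4) by simp
  qed
  have Sb: "0 \<le> S x \<and> S x \<le> 1" for x
    using monoS[of 0 x] monoS[of x 1] S0[of x] S1[of x] S(2) S1[of 1] by (cases "x \<le> 0"; cases "x \<ge> 1") auto
  have P0: "P x = 0" if "x \<le> 0" for x
  proof -
    have "integral {x..0} S = 0"
      by (rule integral_unique, rule has_integral_is_0) (use S0 in auto)
    then show ?thesis using P(1)[OF that] P(2) by simp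
  qed
  have P1: "P x = x + (P 1 - 1)" if "x \<ge> 1" for x
  proof -
    have "integral {1..x} S = integral {1..x} (\<lambda>_. 1)"
      by (rule integral_cong) (use S1 in auto)
    then show ?thesis using P(1)[OF that] that by simp
  qed
  have "0 \<le> P x \<and> P x \<le> max 0 x" for x
  proof (cases "x \<le> 0")
    case True
    then show ?thesis using P0 by simp
  next
    case False
    have "P 0 \<le> P x"
      by (rule DERIV_nonneg_imp_nondecreasing[where f = P]) (use False dP Sb in \<open>simp, blast\<close>)
    moreover have "0 - P 0 \<le> x - P x"
    proof (rule DERIV_nonneg_imp_nondecreasing[where f = "\<lambda>x. x - P x"])
      show "\<exists>y'. ((\<lambda>x. x - P x) has_real_derivative y') (at y) \<and> 0 \<le> y'" for y
        by (rule exI[of _ "1 - S y"]) (use Sb in \<open>auto intro!: derivative_eq_intros dP\<close>)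
    qed (use False in auto)
    ultimately show ?thesis using P(2) False by simp
  qed
  then show ?thesis
    using that[of P S "P 1 - 1"] smooth dP P0 P1 S0 S1 Sb by blast
qed

section \<open>Weak derivatives and primitives\<close>

lemma test_fun_has_derivative:
  "test_fun \<psi> \<Longrightarrow> (\<psi> has_real_derivative deriv \<psi> x) (at x)"
  unfolding test_fun_def by (metis DERIV_deriv_iff_real_differentiable funpow_0)

lemma test_fun_continuous: "test_fun \<psi> \<Longrightarrow> continuous_on A \<psi>"
  by (meson DERIV_isCont continuous_at_imp_continuous_on test_fun_has_derivative)

lemma test_fun_deriv:
  assumes "test_fun \<psi>"
  shows "test_fun (deriv \<psi>)"
proof -
  obtain a b where ab: "\<And>x. x \<notin> {a..b} \<Longrightarrow> \<psi> x = 0"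
    using assms unfolding test_fun_def by blast
  have "deriv \<psi> x = 0" if x: "x \<notin> {a..b}" for x
  proof -
    have "((\<lambda>_. 0) has_real_derivative 0) (at x)" by simp
    then have "(\<psi> has_real_derivative 0) (at x)"
      by (rule has_field_derivative_transform_within_open[where S = "- {a..b}"])
         (use x ab in \<open>auto simp: open_Compl\<close>)
    then show ?thesis by (rule DERIV_imp_deriv)
  qed
  moreover have "((deriv ^^ k) (deriv \<psi>)) differentiable (at x)" for k x
    using assms unfolding test_fun_def by (metis comp_apply funpow_Suc_right)
  ultimately show ?thesis
    unfolding test_fun_def by blast
qed

lemma loc_int_integrable: "loc_int f \<Longrightarrow> f integrable_on {a..b}"
  unfolding loc_int_def using absolutely_integrable_on_def by blast

lemma loc_int_continuous: "continuous_on UNIV f \<Longrightarrow> loc_int f"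
  unfolding loc_int_def
  by (meson absolutely_integrable_continuous_real continuous_on_subset subset_UNIV)

lemma loc_int_mult_continuous:
  assumes "loc_int f" "continuous_on {a..b} k"
  shows "(\<lambda>x. f x * k x) absolutely_integrable_on {a..b}"
proof -
  have "k \<in> borel_measurable (lebesgue_on {a..b})"
    by (rule continuous_imp_measurable_on_sets_lebesgue[OF assms(2)]) simp
  moreover have "bounded (k ` {a..b})"
    by (intro compact_imp_bounded compact_continuous_image assms(2)) simp
  ultimately have "(\<lambda>x. k x * f x) absolutely_integrable_on {a..b}"
    using assms(1) unfolding loc_int_def
    by (intro absolutely_integrable_bounded_measurable_product_real) auto
  then show ?thesis by (simp add: mult.commute)
qed

lemma integral_supported:
  fixes f :: "real \<Rightarrow> real"
  assumes "\<And>x. x \<notin> {a..b} \<Longrightarrow> f x = 0"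
  shows "integral UNIV f = integral {a..b} f"
proof -
  have "(\<lambda>x. if x \<in> {a..b} then f x else 0) = f"
    using assms by auto
  then show ?thesis
    using Henstock_Kurzweil_Integration.integral_restrict_UNIV[of "{a..b}" f] by metis
qed

lemma loc_int_mult_test_fun:
  assumes "loc_int f" "test_fun \<psi>"
  shows "(\<lambda>x. f x * \<psi> x) integrable_on UNIV"
proof -
  obtain a b where ab: "\<And>x. x \<notin> {a..b} \<Longrightarrow> \<psi> x = 0"
    using assms unfolding test_fun_def by blast
  have "(\<lambda>x. f x * \<psi> x) integrable_on {a..b}"
    using loc_int_mult_continuous[OF assms(1) test_fun_continuous[OF assms(2)]]
    using absolutely_integrable_on_def by blast
  then have "(\<lambda>x. if x \<in> {a..b} then f x * \<psi> x else 0) integrable_on UNIV"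
    by (simp only: integrable_restrict_UNIV)
  moreover have "(\<lambda>x. if x \<in> {a..b} then f x * \<psi> x else 0) = (\<lambda>x. f x * \<psi> x)"
    using ab by auto
  ultimately show ?thesis by simp
qed

text \<open>Dominated convergence with majorant \<open>\<bar>f x\<bar> * K\<close>; it serves the
  later passages to piecewise linear and step functions.\<close>

lemma loc_int_mult_dominated:
  assumes f: "loc_int f" and cont: "\<And>n. continuous_on {a..b} (k n)"
    and bound: "\<And>n x. x \<in> {a..b} \<Longrightarrow> \<bar>k n x\<bar> \<le> K"
    and lim: "\<And>x. x \<in> {a..b} \<Longrightarrow> (\<lambda>n. k n x) \<longlonglongrightarrow> l x"
  shows "(\<lambda>n. integral {a..b} (\<lambda>x. f x * k n x)) \<longlonglongrightarrow> integral {a..b} (\<lambda>x. f x * l x)"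
proof (rule dominated_convergence(2))
  show "(\<lambda>x. f x * k n x) integrable_on {a..b}" for n
    using loc_int_mult_continuous[OF f cont] absolutely_integrable_on_def by blast
  show "(\<lambda>x. \<bar>f x\<bar> * K) integrable_on {a..b}"
    using f unfolding loc_int_def absolutely_integrable_on_def by (auto intro: integrable_on_mult_left)
  show "norm (f x * k n x) \<le> \<bar>f x\<bar> * K" if "x \<in> {a..b}" for n x
    using bound[OF that] by (auto simp: abs_mult intro: mult_left_mono)
  show "(\<lambda>n. f x * k n x) \<longlonglongrightarrow> f x * l x" if "x \<in> {a..b}" for x
    by (intro tendsto_intros lim that)
qed

lemma has_integral_mult_step:
  assumes "loc_int f" "y \<le> s"
  shows "((\<lambda>t. f t * (if t > s then 1 else 0)) has_integral integral {s..z} f) {y..z}"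
proof -
  have "(f has_integral integral {s..z} f) {s..z}"
    using loc_int_integrable[OF assms(1)] by (simp add: has_integral_integral)
  then have "((\<lambda>t. if t \<in> {s..z} then f t else 0) has_integral integral {s..z} f) {y..z}"
    by (subst has_integral_restrict) (use assms(2) in auto)
  then show ?thesis
    by (rule has_integral_spike[rotated 2, where S = "{s}"]) auto
qed

section \<open>Testing against trapezoids\<close>

text \<open>Away from the corners its slope is the indicator of [x, x+h] minus that of [y, y+h]. For
  \<open>y < x\<close> and \<open>h \<le> x - y\<close> it drops to -h, stays there between
  \<open>y + h\<close> and \<open>x\<close>, and returns to 0.\<close>

definition trapezoid :: "real \<Rightarrow> real \<Rightarrow> real \<Rightarrow> real \<Rightarrow> real" where
  "trapezoid x y h t = max 0 (t - x) - max 0 (t - x - h) - max 0 (t - y) + max 0 (t - y - h)"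

text \<open>This is the weak derivative tested against a trapezoid. As a trapezoid has corners, its
  four ramps are smoothed at scale 1/N and both sides pass to the limit by dominated
  convergence.\<close>

lemma weak_deriv_trapezoid:
  assumes f: "loc_int f" and wd: "weak_deriv f g" and yx: "y < x" and h: "h > 0" and z: "z \<ge> x + h + 1"
  shows "integral {x..x+h} f - integral {y..y+h} f = - integral {y..z} (\<lambda>t. g t * trapezoid x y h t)"
proof -
  obtain P S :: "real \<Rightarrow> real" and q where smooth: "\<And>n. times_differentiable n P"
    and dP: "\<And>x. (P has_real_derivative S x) (at x)"
    and P0: "\<And>x. x \<le> 0 \<Longrightarrow> P x = 0" and P1: "\<And>x. x \<ge> 1 \<Longrightarrow> P x = x + q"
    and S0: "\<And>x. x \<le> 0 \<Longrightarrow> S x = 0" and S1: "\<And>x. x \<ge> 1 \<Longrightarrow> S x = 1"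
    and Sb: "\<And>x. 0 \<le> S x \<and> S x \<le> 1" and Pb: "\<And>x. 0 \<le> P x \<and> P x \<le> max 0 x"
    using exists_smooth_ramp by metis
  have g: "loc_int g" using wd unfolding weak_deriv_def by blast
  define N where "N n = real (Suc n)" for n
  have N: "N n \<ge> 1" for n by (simp add: N_def)
  have Ninf: "filterlim N at_top sequentially"
    unfolding N_def using filterlim_compose[OF filterlim_real_sequentially filterlim_Suc] .
  \<comment> \<open>Each max 0 (t - s) of the trapezoid is replaced by P(N (t - s)) / N; the sums
    and affine arguments are spelled out to match the closure rules of
    \<open>times_differentiable\<close>.\<close>
  define \<psi> where "\<psi> n t = (1 / N n) * (P (N n * t + - (N n * x)) + (-1) * P (N n * t + - (N n * (x + h)))
      + (-1) * P (N n * t + - (N n * y)) + P (N n * t + - (N n * (y + h))))" for n t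
  define \<sigma> where "\<sigma> n t = S (N n * t + - (N n * x)) - S (N n * t + - (N n * (x + h)))
      - S (N n * t + - (N n * y)) + S (N n * t + - (N n * (y + h)))" for n t
  have \<psi>_eq: "\<psi> n t = (1 / N n) * P (N n * t + - (N n * x)) - (1 / N n) * P (N n * t + - (N n * (x + h)))
      - (1 / N n) * P (N n * t + - (N n * y)) + (1 / N n) * P (N n * t + - (N n * (y + h)))" for n t
    unfolding \<psi>_def distrib_left by simp
  have d\<psi>: "(\<psi> n has_real_derivative \<sigma> n t) (at t)" for n t
  proof -
    have "((\<lambda>t. P (N n * t + - s)) has_real_derivative S (N n * t + - s) * N n) (at t)" for s
      by (rule DERIV_chain2[OF dP]) (auto intro!: derivative_eq_intros)
    note * = this
    show ?thesis
      unfolding \<psi>_def \<sigma>_def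
      by (rule derivative_eq_intros * refl)+ (use N[of n] in \<open>simp add: field_simps\<close>)
  qed
  have deriv\<psi>: "deriv (\<psi> n) = \<sigma> n" for n
    using d\<psi> by (auto intro: DERIV_imp_deriv)
  \<comment> \<open>From \<open>z\<close> on, every knot \<open>s \<le> x + h\<close> is at distance
    at least 1, so all four ramps have entered their affine range.\<close>
  have eval: "N n * t + - (N n * s) \<ge> 1" if "t \<ge> z" "s \<le> x + h" for n t s
  proof -
    have "1 * 1 \<le> N n * (t - s)"
      by (rule mult_mono) (use N[of n] that z in auto)
    then show ?thesis by (simp add: algebra_simps)
  qed
  have eval0: "N n * t + - (N n * s) \<le> 0" if "t \<le> s" for n t s
    using mult_left_mono[OF that, of "N n"] N[of n] by simp
  have \<psi>z: "\<psi> n t = 0" if "t \<notin> {y..z}" for n t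
  proof (cases "t < y")
    case True
    have "P (N n * t + - (N n * s)) = 0" if "s \<ge> y" for s
      using P0 eval0[of t s n] True that by simp
    then show ?thesis using yx h by (simp add: \<psi>_def)
  next
    case False
    then have "t \<ge> z" using that by simp
    have "P (N n * t + - (N n * s)) = N n * t - N n * s + q" if "s \<le> x + h" for s
      using P1[OF eval[OF \<open>t \<ge> z\<close> that]] by simp
    \<comment> \<open>The slopes, the knots and the four offsets \<open>q\<close> cancel, so the
      smoothed trapezoid has compact support.\<close>
    then have "\<psi> n t = (1 / N n) * ((N n * t - N n * x + q) + (-1) * (N n * t - N n * (x + h) + q)
      + (-1) * (N n * t - N n * y + q) + (N n * t - N n * (y + h) + q))"
      unfolding \<psi>_def using yx h by simp
    also have "\<dots> = 0" by (simp add: algebra_simps)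
    finally show ?thesis .
  qed
  have \<sigma>z: "\<sigma> n t = 0" if "t \<notin> {y..z}" for n t
  proof (cases "t < y")
    case True
    have "S (N n * t + - (N n * s)) = 0" if "s \<ge> y" for s
      using S0 eval0[of t s n] True that by simp
    then show ?thesis using yx h by (simp add: \<sigma>_def)
  next
    case False
    then have "t \<ge> z" using that by simp
    then show ?thesis using yx h S1[OF eval] by (simp add: \<sigma>_def)
  qed
  have test: "test_fun (\<psi> n)" for n
  proof -
    have "times_differentiable k (\<psi> n)" for k
      unfolding \<psi>_def
      by (intro times_differentiable_mult times_differentiable_add times_differentiable_const
          times_differentiable_affine smooth)
    then show ?thesis
      unfolding test_fun_def using times_differentiable_imp_deriv \<psi>z by blast
  qed
  have id: "integral {y..z} (\<lambda>t. f t * \<sigma> n t) = - integral {y..z} (\<lambda>t. g t * \<psi> n t)" for n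
  proof -
    have "integral UNIV (\<lambda>t. f t * deriv (\<psi> n) t) = - integral UNIV (\<lambda>t. g t * \<psi> n t)"
      using wd test unfolding weak_deriv_def by blast
    then show ?thesis
      using integral_supported[of y z "\<lambda>t. f t * \<sigma> n t"] integral_supported[of y z "\<lambda>t. g t * \<psi> n t"]
      by (simp add: deriv\<psi> \<sigma>z \<psi>z)
  qed
  have ev: "eventually (\<lambda>n. N n * t + - (N n * s) \<ge> 1) sequentially" if "t > s" for t s
  proof -
    have "eventually (\<lambda>n. N n \<ge> 1 / (t - s)) sequentially"
      using Ninf by (simp add: filterlim_at_top)
    then show ?thesis
      by eventually_elim (use that in \<open>simp add: field_simps\<close>)
  qed
  have limS: "(\<lambda>n. S (N n * t + - (N n * s))) \<longlonglongrightarrow> (if t > s then 1 else 0)" for t s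
  proof (cases "t > s")
    case True
    then show ?thesis
      by (auto intro!: tendsto_eventually eventually_mono[OF ev[OF True]] S1)
  next
    case False
    then show ?thesis
      using S0[OF eval0] by simp
  qed
  have limP: "(\<lambda>n. (1 / N n) * P (N n * t + - (N n * s))) \<longlonglongrightarrow> max 0 (t - s)" for t s
  proof (cases "t > s")
    case True
    have "(\<lambda>n. (t - s) + q / N n) \<longlonglongrightarrow> (t - s) + 0"
      by (intro tendsto_intros real_tendsto_divide_at_top[OF tendsto_const Ninf])
    then have "(\<lambda>n. (1 / N n) * P (N n * t + - (N n * s))) \<longlonglongrightarrow> (t - s) + 0"
    proof (rule Lim_transform_eventually)
      show "\<forall>\<^sub>F n in sequentially. t - s + q / N n = 1 / N n * P (N n * t + - (N n * s))"
        using ev[OF True]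
      proof eventually_elim
        case (elim n)
        then show ?case using N[of n] by (simp add: P1 field_simps)
      qed
    qed
    then show ?thesis using True by simp
  next
    case False
    then show ?thesis
      using P0[OF eval0] by simp
  qed
  have cont\<psi>: "continuous_on A (\<psi> n)" for A n
    using test test_fun_continuous by blast
  have cont\<sigma>: "continuous_on A (\<sigma> n)" for A n
    using test_fun_continuous[OF test_fun_deriv[OF test]] deriv\<psi> by metis
  have "(\<lambda>n. integral {y..z} (\<lambda>t. f t * \<sigma> n t)) \<longlonglongrightarrow> integral {y..z} (\<lambda>t. f t *
      ((if t > x then 1 else 0) - (if t > x + h then 1 else 0) - (if t > y then 1 else 0) + (if t > y + h then 1 else 0)))"
  proof (rule loc_int_mult_dominated[OF f cont\<sigma>])
    show "\<bar>\<sigma> n t\<bar> \<le> 4" for n t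
      using Sb[of "N n * t + - (N n * x)"] Sb[of "N n * t + - (N n * (x + h))"]
        Sb[of "N n * t + - (N n * y)"] Sb[of "N n * t + - (N n * (y + h))"]
      unfolding \<sigma>_def by linarith
    show "(\<lambda>n. \<sigma> n t) \<longlonglongrightarrow>
      (if t > x then 1 else 0) - (if t > x + h then 1 else 0) - (if t > y then 1 else 0) + (if t > y + h then 1 else 0)" for t
      unfolding \<sigma>_def by (intro tendsto_intros limS)
  qed
  also have "integral {y..z} (\<lambda>t. f t *
      ((if t > x then 1 else 0) - (if t > x + h then 1 else 0) - (if t > y then 1 else 0) + (if t > y + h then 1 else 0)))
     = integral {x..z} f - integral {x+h..z} f - integral {y..z} f + integral {y+h..z} f"
  proof (rule integral_unique)
    show "((\<lambda>t. f t *
      ((if t > x then 1 else 0) - (if t > x + h then 1 else 0) - (if t > y then 1 else 0) + (if t > y + h then 1 else 0)))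
      has_integral
        (integral {x..z} f - integral {x+h..z} f - integral {y..z} f + integral {y+h..z} f)) {y..z}"
      unfolding distrib_left right_diff_distrib
      by (intro has_integral_add has_integral_diff has_integral_mult_step f) (use yx h in auto)
  qed
  also have "\<dots> = integral {x..x+h} f - integral {y..y+h} f"
  proof -
    have "integral {x..x+h} f + integral {x+h..z} f = integral {x..z} f"
      "integral {y..y+h} f + integral {y+h..z} f = integral {y..z} f"
      by (rule Henstock_Kurzweil_Integration.integral_combine; use yx z h loc_int_integrable[OF f] in simp)+
    then show ?thesis by linarith
  qed
  finally have 1: "(\<lambda>n. integral {y..z} (\<lambda>t. f t * \<sigma> n t)) \<longlonglongrightarrow> integral {x..x+h} f - integral {y..y+h} f" .
  have "(\<lambda>n. integral {y..z} (\<lambda>t. g t * \<psi> n t)) \<longlonglongrightarrow> integral {y..z} (\<lambda>t. g t * trapezoid x y h t)"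
  proof (rule loc_int_mult_dominated[OF g cont\<psi>])
    have "0 \<le> (1 / N n) * P (N n * t + - (N n * s)) \<and> (1 / N n) * P (N n * t + - (N n * s)) \<le> z - y"
      if "t \<in> {y..z}" "y \<le> s" for n t s
    proof -
      have "P (N n * t + - (N n * s)) \<le> max 0 (N n * t + - (N n * s))"
        using Pb by blast
      also have "\<dots> \<le> N n * (z - y)"
      proof -
        have "N n * (t - s) \<le> N n * (z - y)" "0 \<le> N n * (z - y)"
          using that N[of n] by (auto intro!: mult_left_mono)
        then show ?thesis by (simp add: algebra_simps)
      qed
      finally show ?thesis using Pb N[of n] by (simp add: field_simps)
    qed
    note b = this
    show "\<bar>\<psi> n t\<bar> \<le> 4 * (z - y)" if "t \<in> {y..z}" for n t
    proof -
      have aux: "\<bar>p1 - p2 - p3 + p4\<bar> \<le> 4 * (z - y)"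
        if "0 \<le> p1 \<and> p1 \<le> z - y" "0 \<le> p2 \<and> p2 \<le> z - y" "0 \<le> p3 \<and> p3 \<le> z - y" "0 \<le> p4 \<and> p4 \<le> z - y"
        for p1 p2 p3 p4
        unfolding abs_le_iff using that by auto
      show ?thesis
        unfolding \<psi>_eq by (rule aux; rule b[OF that]; use yx h in simp)
    qed
    have "(\<lambda>n. (1 / N n) * P (N n * t + - (N n * x)) - (1 / N n) * P (N n * t + - (N n * (x + h)))
      - (1 / N n) * P (N n * t + - (N n * y)) + (1 / N n) * P (N n * t + - (N n * (y + h)))) \<longlonglongrightarrow>
      max 0 (t - x) - max 0 (t - (x + h)) - max 0 (t - y) + max 0 (t - (y + h))" for t
      by (intro tendsto_add tendsto_diff limP)
    moreover have "max 0 (t - x) - max 0 (t - (x + h)) - max 0 (t - y) + max 0 (t - (y + h)) = trapezoid x y h t" for t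
      unfolding trapezoid_def by (simp only: diff_diff_eq)
    ultimately show "(\<lambda>n. \<psi> n t) \<longlonglongrightarrow> trapezoid x y h t" for t
      by (simp only: \<psi>_eq)
  qed
  then have "(\<lambda>n. integral {y..z} (\<lambda>t. f t * \<sigma> n t)) \<longlonglongrightarrow> - integral {y..z} (\<lambda>t. g t * trapezoid x y h t)"
    unfolding id by (rule tendsto_minus)
  then show ?thesis
    using 1 LIMSEQ_unique by blast
qed

text \<open>Where \<open>f\<close> is the limit of its right averages, dividing the trapezoid identity by \<open>h\<close> and letting \<open>h\<close> tend to \<open>0\<close>
  replaces the trapezoid by the indicator of the interval between the two points.\<close>
lemma weak_deriv_imp_primitive:
  assumes f: "loc_int f" and wd: "weak_deriv f g"
  obtains G N where "\<And>a b. a \<le> b \<Longrightarrow> integral {a..b} g = G b - G a"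
    "negligible N" "\<And>x. x \<notin> N \<Longrightarrow> f x = G x"
proof -
  have g: "loc_int g" using wd unfolding weak_deriv_def by blast
  \<comment> \<open>Lebesgue differentiation with right averages: off the null set \<open>N\<close>
    they converge to \<open>f\<close>.\<close>
  obtain N where N: "negligible N" and leb: "\<And>x e. \<lbrakk>x \<notin> N; 0 < e\<rbrakk> \<Longrightarrow>
      \<exists>d>0. \<forall>h. 0 < h \<and> h < d \<longrightarrow> norm (integral {x..x+h} f / h - f x) < e"
  proof (rule integrable_ccontinuous_explicit[of f])
    show "f integrable_on cbox a b" for a b
      using loc_int_integrable[OF f] by simp
  qed (use that in \<open>auto simp: divide_inverse mult.commute\<close>)
  define H where "H n = 1 / real (Suc n)" for n
  have H: "0 < H n" "H n \<le> 1" for n by (auto simp: H_def)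
  have H0: "H \<longlonglongrightarrow> 0"
    unfolding H_def using LIMSEQ_inverse_real_of_nat by (simp add: inverse_eq_divide)
  have Hev: "eventually (\<lambda>n. H n < e) sequentially" if "e > 0" for e
    using order_tendstoD(2)[OF H0 that] .
  have lebseq: "(\<lambda>n. integral {x..x + H n} f / H n) \<longlonglongrightarrow> f x" if "x \<notin> N" for x
  proof (rule tendstoI)
    fix e :: real assume "e > 0"
    then obtain d where d: "d > 0" "\<And>h. 0 < h \<Longrightarrow> h < d \<Longrightarrow> norm (integral {x..x+h} f / h - f x) < e"
      using leb[OF \<open>x \<notin> N\<close>] by blast
    show "\<forall>\<^sub>F n in sequentially. dist (integral {x..x + H n} f / H n) (f x) < e"
      using Hev[OF d(1)] by eventually_elim (use d(2) H in \<open>simp add: dist_norm\<close>)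
  qed
  have diff: "f x - f y = integral {y..x} g" if xy: "x \<notin> N" "y \<notin> N" "y < x" for x y
  proof -
    \<comment> \<open>One right end for all \<open>n\<close>: \<open>H n \<le> 1\<close> yields
      \<open>z \<ge> x + H n + 1\<close>.\<close>
    define z where "z = x + 2"
    have 1: "(\<lambda>n. integral {x..x + H n} f / H n - integral {y..y + H n} f / H n) \<longlonglongrightarrow> f x - f y"
      by (intro tendsto_diff lebseq xy)
    have eq: "integral {x..x + H n} f / H n - integral {y..y + H n} f / H n =
        - integral {y..z} (\<lambda>t. g t * (trapezoid x y (H n) t / H n))" for n
    proof -
      have "integral {x..x + H n} f - integral {y..y + H n} f
          = - integral {y..z} (\<lambda>t. g t * trapezoid x y (H n) t)"
        by (rule weak_deriv_trapezoid[OF f wd \<open>y < x\<close> H(1)]) (use H(2)[of n] in \<open>simp add: z_def\<close>)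
      moreover have "integral {y..z} (\<lambda>t. g t * (trapezoid x y (H n) t / H n)) =
          integral {y..z} (\<lambda>t. g t * trapezoid x y (H n) t) / H n"
        unfolding times_divide_eq_right by (rule Henstock_Kurzweil_Integration.integral_divide)
      ultimately show ?thesis
        by (simp add: diff_divide_distrib[symmetric])
    qed
    \<comment> \<open>The scaled trapezoids are bounded by 2 and converge to minus the indicator of
      the half-open interval (y, x].\<close>
    have "(\<lambda>n. integral {y..z} (\<lambda>t. g t * (trapezoid x y (H n) t / H n))) \<longlonglongrightarrow>
        integral {y..z} (\<lambda>t. g t * ((if t > x then 1 else 0) - (if t > y then 1 else 0)))"
    proof (rule loc_int_mult_dominated[OF g])
      show "continuous_on {y..z} (\<lambda>t. trapezoid x y (H n) t / H n)" for n
        unfolding trapezoid_def by (intro continuous_intros) (use H(1)[of n] in auto)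
      show "\<bar>trapezoid x y (H n) t / H n\<bar> \<le> 2" for n t
      proof -
        have "\<bar>trapezoid x y (H n) t\<bar> \<le> 2 * H n"
          using H(1)[of n] unfolding trapezoid_def by linarith
        then show ?thesis using H(1)[of n] by (simp add: field_simps)
      qed
      have step: "(\<lambda>n. (max 0 (t - s) - max 0 (t - s - H n)) / H n) \<longlonglongrightarrow> (if t > s then 1 else 0)" for t s
      proof (rule tendsto_eventually, cases "t > s")
        case True
        then have "\<forall>\<^sub>F n in sequentially. H n < t - s" using Hev by simp
        then show "\<forall>\<^sub>F n in sequentially. (max 0 (t - s) - max 0 (t - s - H n)) / H n = (if t > s then 1 else 0)"
          by eventually_elim (use H True in \<open>simp add: less_imp_neq[OF H(1), symmetric]\<close>)
      next
        case False
        have "max 0 (t - s - H n) = 0" for n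
          using False H(1)[of n] by linarith
        then show "\<forall>\<^sub>F n in sequentially. (max 0 (t - s) - max 0 (t - s - H n)) / H n = (if t > s then 1 else 0)"
          using False by simp
      qed
      show "(\<lambda>n. trapezoid x y (H n) t / H n) \<longlonglongrightarrow> (if t > x then 1 else 0) - (if t > y then 1 else 0)" for t
      proof -
        have "trapezoid x y (H n) t / H n = (max 0 (t - x) - max 0 (t - x - H n)) / H n
            - (max 0 (t - y) - max 0 (t - y - H n)) / H n" for n
          unfolding trapezoid_def diff_divide_distrib add_divide_distrib by linarith
        then show ?thesis
          using tendsto_diff[OF step[of t x] step[of t y]] by presburger
      qed
    qed
    also have "integral {y..z} (\<lambda>t. g t * ((if t > x then 1 else 0) - (if t > y then 1 else 0)))
       = integral {x..z} g - integral {y..z} g"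
    proof (rule integral_unique)
      show "((\<lambda>t. g t * ((if t > x then 1 else 0) - (if t > y then 1 else 0))) has_integral
         integral {x..z} g - integral {y..z} g) {y..z}"
        unfolding right_diff_distrib
        by (intro has_integral_diff has_integral_mult_step g) (use xy in auto)
    qed
    also have "\<dots> = - integral {y..x} g"
    proof -
      have "integral {y..x} g + integral {x..z} g = integral {y..z} g"
        by (rule Henstock_Kurzweil_Integration.integral_combine)
           (use xy loc_int_integrable[OF g] in \<open>simp_all add: z_def\<close>)
      then show ?thesis by linarith
    qed
    finally have "(\<lambda>n. integral {y..z} (\<lambda>t. g t * (trapezoid x y (H n) t / H n))) \<longlonglongrightarrow> - integral {y..x} g" .
    from tendsto_minus[OF this] show ?thesis
      using 1 unfolding eq by (simp add: LIMSEQ_unique)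
  qed
  obtain G where G: "\<And>a b. a \<le> b \<Longrightarrow> integral {a..b} g = G b - G a"
    using exists_primitive[of g 0] loc_int_integrable[OF g] by metis
  \<comment> \<open>\<open>f - G\<close> is constant off \<open>N\<close>; a point \<open>x0\<close>
    outside \<open>N\<close> then fixes the constant of integration.\<close>
  have const: "f x - G x = f y - G y" if "x \<notin> N" "y \<notin> N" for x y
    using diff[of x y] diff[of y x] G[of x y] G[of y x] that by (cases x y rule: linorder_cases) auto
  have "N \<noteq> UNIV" using N by auto
  then obtain x0 where x0: "x0 \<notin> N" by blast
  show ?thesis
  proof (rule that[of "\<lambda>x. G x + (f x0 - G x0)" N])
    show "f x = G x + (f x0 - G x0)" if "x \<notin> N" for x
      using const[OF that x0] by simp
  qed (use G N in auto)
qed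

lemma primitive_continuous:
  fixes g G :: "real \<Rightarrow> real"
  assumes int: "\<And>a b. g integrable_on {a..b}" and G: "\<And>a b. a \<le> b \<Longrightarrow> integral {a..b} g = G b - G a"
  shows "continuous_on UNIV G"
proof (rule continuous_at_imp_continuous_on, rule ballI)
  fix x :: real
  have "continuous_on {x-1..x+1} (\<lambda>u. integral {x-1..u} g + G (x-1))"
    by (intro continuous_intros indefinite_integral_continuous_1 int)
  then have "continuous_on {x-1<..<x+1} G"
    by (rule continuous_on_eq[OF continuous_on_subset]) (auto simp: G)
  then show "isCont G x"
    by (simp add: continuous_on_eq_continuous_at)
qed

section \<open>Extending identities across null sets\<close>

lemma negligible_complement_dense:
  fixes N :: "real set"
  assumes "negligible N"
  shows "closure (- N) = UNIV"
proof -
  have "interior N = {}"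
    using assms negligible_subset[OF assms interior_subset] open_not_negligible[OF open_interior] by blast
  then show ?thesis by (simp add: closure_complement)
qed

lemma negligible_complement_interval:
  fixes N :: "real set"
  assumes "negligible N" "a < b"
  obtains x where "a < x" "x < b" "x \<notin> N"
proof -
  have "\<not> {a<..<b} \<subseteq> N"
    using assms open_not_negligible[of "{a<..<b}"] negligible_subset by (metis greaterThanLessThan_empty_iff not_le open_greaterThanLessThan)
  then obtain x where "x \<in> {a<..<b}" "x \<notin> N" by blast
  then show ?thesis using that by auto
qed

text \<open>The complement of a null set is dense in the open set \<open>S\<close>, so continuity
  carries the identity to the closure. With \<open>S = {..<0}\<close> this reaches the point 0;
  inequalities fit in as max u v = v.\<close>

lemma continuous_eq_off_negligible:
  fixes f g :: "real \<Rightarrow> real"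
  assumes N: "negligible N" and f: "continuous_on UNIV f" and g: "continuous_on UNIV g"
    and S: "open S" and eq: "\<And>x. x \<in> S \<Longrightarrow> x \<notin> N \<Longrightarrow> f x = g x" and x: "x \<in> closure S"
  shows "f x = g x"
proof -
  have "closure (S \<inter> - N) = closure S"
    using S negligible_complement_dense[OF N] by (intro closure_open_Int_superset) auto
  then have x': "x \<in> closure (S \<inter> - N)" using x by simp
  have "continuous_on (closure (S \<inter> - N)) (\<lambda>x. f x - g x)"
    by (intro continuous_on_diff continuous_on_subset[OF f] continuous_on_subset[OF g] subset_UNIV)
  moreover have "f y - g y = 0" if "y \<in> S \<inter> - N" for y
    using that eq by simp
  ultimately have "f x - g x = 0"
    using continuous_constant_on_closure[of "S \<inter> - N" "\<lambda>x. f x - g x" 0 x] x' by simp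
  then show ?thesis by simp
qed

section \<open>The case of exponents at least two\<close>

text \<open>Two integrations: the weak derivative \<open>v\<close> of \<open>f\<close> has weak
  derivative \<open>h\<close>, hence a continuous representative \<open>g\<close>, and the primitive
  of \<open>v\<close> is then a C^1 primitive of \<open>g\<close>.\<close>

lemma W11_second_deriv_imp_C1:
  assumes W: "W11_loc f" and sd: "second_deriv_L1loc f"
  obtains G g N where "continuous_on UNIV g" "\<And>x. (G has_real_derivative g x) (at x)"
    "negligible N" "\<And>x. x \<notin> N \<Longrightarrow> f x = G x"
proof -
  obtain v where f: "loc_int f" and v: "weak_deriv f v"
    using W unfolding W11_loc_def by blast
  obtain h where h: "loc_int h" and fh: "\<And>\<psi>. test_fun \<psi> \<Longrightarrow>
      integral UNIV (\<lambda>x. f x * deriv (deriv \<psi>) x) = integral UNIV (\<lambda>x. h x * \<psi> x)"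
    using sd unfolding second_deriv_L1loc_def by blast
  have li: "loc_int v" using v unfolding weak_deriv_def by blast
  have "integral UNIV (\<lambda>x. v x * deriv \<psi> x) = - integral UNIV (\<lambda>x. h x * \<psi> x)" if "test_fun \<psi>" for \<psi>
  proof -
    have "integral UNIV (\<lambda>x. f x * deriv (deriv \<psi>) x) = - integral UNIV (\<lambda>x. v x * deriv \<psi> x)"
      using v test_fun_deriv[OF that] unfolding weak_deriv_def by blast
    then show ?thesis using fh[OF that] by simp
  qed
  then have "weak_deriv v h"
    unfolding weak_deriv_def using h by blast
  then obtain g N1 where g: "\<And>a b. a \<le> b \<Longrightarrow> integral {a..b} h = g b - g a"
    and N1: "negligible N1" "\<And>x. x \<notin> N1 \<Longrightarrow> v x = g x"
    using weak_deriv_imp_primitive[OF li] by metis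
  obtain G N2 where G: "\<And>a b. a \<le> b \<Longrightarrow> integral {a..b} v = G b - G a"
    and N2: "negligible N2" "\<And>x. x \<notin> N2 \<Longrightarrow> f x = G x"
    using weak_deriv_imp_primitive[OF f v] by metis
  have contg: "continuous_on UNIV g"
    using primitive_continuous[OF loc_int_integrable[OF h] g] .
  have "integral {a..b} g = G b - G a" if "a \<le> b" for a b
    using G[OF that] integral_spike[OF N1(1), of "{a..b}" g v] N1(2) by simp
  then have "(G has_real_derivative g x) (at x)" for x
    using primitive_has_real_derivative[OF contg] by blast
  then show ?thesis
    using that contg N2 by blast
qed

text \<open>A C^1 representative vanishing on the left has value and slope 0 at 0, so it is o(t).
  Off a null set the profile keeps it above (C1 / 2) t powr \<alpha> near 0, which is at least (C1 /
  2) t for t < 1.\<close>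

lemma sharp_corner_not_second_deriv_L1loc:
  fixes \<alpha> \<Lambda> C1 C2 :: real
  assumes W: "W11_loc f" and zero: "\<And>t. t \<le> 0 \<Longrightarrow> f t = 0"
    and \<alpha>: "\<alpha> \<le> 1" and \<Lambda>: "\<Lambda> > \<alpha>" and C1: "C1 > 0" and C2: "C2 > 0"
    and asym: "\<And>t. 0 < t \<Longrightarrow> t < 1 \<Longrightarrow> \<bar>f t - C1 * t powr \<alpha>\<bar> \<le> C2 * t powr \<Lambda>"
  shows "\<not> second_deriv_L1loc f"
proof
  assume "second_deriv_L1loc f"
  then obtain G g N where contg: "continuous_on UNIV g" and G: "\<And>x. (G has_real_derivative g x) (at x)"
    and N: "negligible N" "\<And>x. x \<notin> N \<Longrightarrow> f x = G x"
    using W11_second_deriv_imp_C1[OF W] by metis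
  have contG: "continuous_on UNIV G"
    using G by (meson DERIV_isCont continuous_at_imp_continuous_on)
  have G0: "G t = 0" if "t \<le> 0" for t
  proof (rule continuous_eq_off_negligible[OF N(1) contG continuous_on_const open_lessThan[of 0]])
    show "G x = 0" if "x \<in> {..<0}" "x \<notin> N" for x
      using N(2)[of x] zero[of x] that by simp
  qed (use that in simp)
  have "g t = 0" if "t < 0" for t
  proof -
    have "((\<lambda>_. 0) has_real_derivative 0) (at t)" by simp
    then have "(G has_real_derivative 0) (at t)"
      by (rule has_field_derivative_transform_within_open[where S = "{..<0}"]) (use that G0 in auto)
    then show ?thesis using G DERIV_unique by blast
  qed
  then have "g 0 = 0"
    by (rule continuous_eq_off_negligible[OF negligible_empty contg continuous_on_const open_lessThan[of 0]]) auto
  with G[of 0] G0[of 0] have lim: "((\<lambda>t. G t / t) \<longlongrightarrow> 0) (at 0)"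
    by (simp add: DERIV_def)
  \<comment> \<open>As \<Lambda> - \<alpha> > 0, the remainder is below half of the leading term
    close to 0.\<close>
  have "((\<lambda>t. C2 * t powr (\<Lambda> - \<alpha>)) \<longlongrightarrow> C2 * 0 powr (\<Lambda> - \<alpha>)) (at_right 0)"
    using \<Lambda> by (intro tendsto_intros tendsto_powr2) (auto simp: eventually_at_filter)
  then have "\<forall>\<^sub>F t in at_right 0. C2 * t powr (\<Lambda> - \<alpha>) < C1 / 2"
    using C1 by (intro order_tendstoD(2)) auto
  moreover have "\<forall>\<^sub>F t in at_right 0. G t / t < C1 / 2"
    using order_tendstoD(2)[OF lim, of "C1 / 2"] C1 by (simp add: eventually_at_split)
  ultimately have "\<forall>\<^sub>F t in at_right 0. C2 * t powr (\<Lambda> - \<alpha>) < C1 / 2 \<and> G t / t < C1 / 2"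
    by eventually_elim simp
  then obtain e where e: "e > 0" "\<And>t. 0 < t \<Longrightarrow> t < e \<Longrightarrow> C2 * t powr (\<Lambda> - \<alpha>) < C1 / 2 \<and> G t / t < C1 / 2"
    by (auto simp: eventually_at_right_field)
  \<comment> \<open>The point must avoid \<open>N\<close>, where \<open>f\<close> and
    \<open>G\<close> may differ.\<close>
  obtain t where t: "0 < t" "t < min e 1" "t \<notin> N"
    using negligible_complement_interval[OF N(1), of 0 "min e 1"] e(1) by auto
  have "C1 * t powr \<alpha> - C2 * t powr \<Lambda> \<le> G t"
    using asym[of t] N(2)[OF t(3)] t by auto
  moreover have "C2 * t powr \<Lambda> \<le> C1 / 2 * t powr \<alpha>"
  proof -
    have "C2 * t powr \<Lambda> = (C2 * t powr (\<Lambda> - \<alpha>)) * t powr \<alpha>"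
      by (simp add: powr_add[symmetric])
    also have "\<dots> \<le> C1 / 2 * t powr \<alpha>"
      by (rule mult_right_mono) (use e(2)[of t] t in auto)
    finally show ?thesis .
  qed
  moreover have "C1 / 2 * t \<le> C1 / 2 * t powr \<alpha>"
    using powr_mono'[of \<alpha> 1 t] \<alpha> t C1 by simp
  moreover have "G t < C1 / 2 * t"
    using e(2)[of t] t by (simp add: field_simps)
  ultimately show False by linarith
qed

section \<open>Regularity and positivity of the representative\<close>

text \<open>The flux D (\<phi> powr m)' - c \<phi> has the continuous weak derivative d(p) - b(p(. -
  c r)), hence a C^1 representative \<open>w\<close>; this makes the derivative of p powr m
  continuous.\<close>

lemma wave_regular_representative:
  assumes m: "m > 0" and D: "D > 0"
    and contb: "continuous_on {0..} b" and contd: "continuous_on {0..} d"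
    and nonneg: "\<And>t. 0 \<le> \<phi> t" and W: "W11_loc \<phi>" and Wm: "W11_loc (\<lambda>t. \<phi> t powr m)"
    and eqn: "wave_eq_distr m D r b d c \<phi>" and zero: "\<And>t. t \<le> 0 \<Longrightarrow> \<phi> t = 0"
  obtains p w N where "continuous_on UNIV p" "\<And>t. 0 \<le> p t" "\<And>t. t \<le> 0 \<Longrightarrow> p t = 0"
    "negligible N" "\<And>t. t \<notin> N \<Longrightarrow> \<phi> t = p t"
    "\<And>t. ((\<lambda>t. p t powr m) has_real_derivative (w t + c * p t) / D) (at t)"
    "\<And>t. (w has_real_derivative d (p t) - b (p (t - c * r))) (at t)" "w 0 = 0"
proof -
  obtain g where \<phi>: "loc_int \<phi>" and g: "weak_deriv \<phi> g"
    using W unfolding W11_loc_def by blast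
  obtain p N where p: "\<And>a b. a \<le> b \<Longrightarrow> integral {a..b} g = p b - p a"
    and N: "negligible N" "\<And>t. t \<notin> N \<Longrightarrow> \<phi> t = p t"
    using weak_deriv_imp_primitive[OF \<phi> g] by metis
  have "loc_int g" using g unfolding weak_deriv_def by blast
  then have contp: "continuous_on UNIV p"
    using primitive_continuous[OF loc_int_integrable p] by blast
  have p_nonneg: "0 \<le> p t" for t
  proof -
    \<comment> \<open>Writing nonnegativity as an equality of continuous functions lets density
      apply.\<close>
    have "p t = max 0 (p t)"
    proof (rule continuous_eq_off_negligible[OF N(1) contp _ open_UNIV])
      show "continuous_on UNIV (\<lambda>t. max 0 (p t))" by (intro continuous_intros contp)
      show "p x = max 0 (p x)" if "x \<notin> N" for x
        using N(2)[OF that] nonneg[of x] by simp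
    qed simp
    then show ?thesis by linarith
  qed
  have p0: "p t = 0" if "t \<le> 0" for t
  proof (rule continuous_eq_off_negligible[OF N(1) contp continuous_on_const open_lessThan[of 0]])
    show "p x = 0" if "x \<in> {..<0}" "x \<notin> N" for x
      using N(2)[of x] zero[of x] that by simp
  qed (use that in simp)
  obtain v where u: "loc_int (\<lambda>t. \<phi> t powr m)" and v: "weak_deriv (\<lambda>t. \<phi> t powr m) v"
    using Wm unfolding W11_loc_def by blast
  have liv: "loc_int v" using v unfolding weak_deriv_def by blast
  obtain U N2 where U: "\<And>a b. a \<le> b \<Longrightarrow> integral {a..b} v = U b - U a"
    and N2: "negligible N2" "\<And>t. t \<notin> N2 \<Longrightarrow> \<phi> t powr m = U t"
    using weak_deriv_imp_primitive[OF u v] by metis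
  have contU: "continuous_on UNIV U"
    using primitive_continuous[OF loc_int_integrable[OF liv] U] by blast
  have U_eq: "U t = p t powr m" for t
  proof (rule continuous_eq_off_negligible[OF negligible_Un[OF N(1) N2(1)] contU _ open_UNIV])
    show "continuous_on UNIV (\<lambda>t. p t powr m)"
      by (intro continuous_on_powr' contp continuous_on_const) (use p_nonneg m in auto)
    show "U x = p x powr m" if "x \<notin> N \<union> N2" for x
      using N(2)[of x] N2(2)[of x] that by simp
  qed simp
  have contdp: "continuous_on UNIV (\<lambda>t. d (p t))"
    by (rule continuous_on_compose2[OF contd contp]) (use p_nonneg in auto)
  have contbp: "continuous_on UNIV (\<lambda>t. b (p (t - c * r)))"
    by (rule continuous_on_compose2[OF contb continuous_on_compose2[OF contp]])
       (use p_nonneg in \<open>auto intro!: continuous_intros\<close>)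
  define F where "F t = d (p t) - b (p (t - c * r))" for t
  have contF: "continuous_on UNIV F"
    unfolding F_def by (intro continuous_intros contdp contbp)
  define V where "V t = D * v t - c * \<phi> t" for t
  have liV: "loc_int V"
    unfolding V_def loc_int_def
    using liv \<phi> by (intro allI set_integral_diff absolutely_integrable_scaleR_left) (auto simp: loc_int_def)
  have "integral UNIV (\<lambda>t. V t * deriv \<psi> t) = - integral UNIV (\<lambda>t. F t * \<psi> t)" if \<psi>: "test_fun \<psi>" for \<psi>
  proof -
    have "integral UNIV (\<lambda>t. \<phi> t powr m * deriv (deriv \<psi>) t) = - integral UNIV (\<lambda>t. v t * deriv \<psi> t)"
      using v test_fun_deriv[OF \<psi>] unfolding weak_deriv_def by blast
    moreover have "- c * integral UNIV (\<lambda>t. \<phi> t * deriv \<psi> t) =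
          D * integral UNIV (\<lambda>t. \<phi> t powr m * deriv (deriv \<psi>) t)
          - integral UNIV (\<lambda>t. d (\<phi> t) * \<psi> t)
          + integral UNIV (\<lambda>t. b (\<phi> (t - c * r)) * \<psi> t)"
      using eqn \<psi> unfolding wave_eq_distr_def by blast
    moreover have "integral UNIV (\<lambda>t. d (\<phi> t) * \<psi> t) = integral UNIV (\<lambda>t. d (p t) * \<psi> t)"
      by (rule integral_spike[OF N(1)]) (use N(2) in auto)
    moreover have "integral UNIV (\<lambda>t. b (\<phi> (t - c * r)) * \<psi> t) = integral UNIV (\<lambda>t. b (p (t - c * r)) * \<psi> t)"
    \<comment> \<open>The delay shifts the exceptional null set by \<open>c * r\<close>.\<close>
    proof (rule integral_spike[OF negligible_translation[OF N(1), of "c * r"]])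
      fix t assume "t \<in> UNIV - (+) (c * r) ` N"
      then have "t - c * r \<notin> N"
        by (metis DiffD2 add.commute diff_add_cancel image_eqI)
      then show "b (p (t - c * r)) * \<psi> t = b (\<phi> (t - c * r)) * \<psi> t"
        using N(2) by simp
    qed
    moreover have "integral UNIV (\<lambda>t. F t * \<psi> t) =
        integral UNIV (\<lambda>t. d (p t) * \<psi> t) - integral UNIV (\<lambda>t. b (p (t - c * r)) * \<psi> t)"
      unfolding F_def left_diff_distrib
      by (intro Henstock_Kurzweil_Integration.integral_diff loc_int_mult_test_fun loc_int_continuous contdp contbp \<psi>)
    moreover have "integral UNIV (\<lambda>t. V t * deriv \<psi> t) =
        D * integral UNIV (\<lambda>t. v t * deriv \<psi> t) - c * integral UNIV (\<lambda>t. \<phi> t * deriv \<psi> t)"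
    proof -
      have "(\<lambda>t. v t * deriv \<psi> t) integrable_on UNIV" "(\<lambda>t. \<phi> t * deriv \<psi> t) integrable_on UNIV"
        by (intro loc_int_mult_test_fun liv \<phi> test_fun_deriv \<psi>)+
      then have "integral UNIV (\<lambda>t. D * (v t * deriv \<psi> t) - c * (\<phi> t * deriv \<psi> t)) =
          D * integral UNIV (\<lambda>t. v t * deriv \<psi> t) - c * integral UNIV (\<lambda>t. \<phi> t * deriv \<psi> t)"
        by (subst Henstock_Kurzweil_Integration.integral_diff) (auto intro: integrable_on_mult_right)
      then show ?thesis
        by (simp add: V_def left_diff_distrib mult.assoc)
    qed
    ultimately show ?thesis by simp
  qed
  then have "weak_deriv V F"
    unfolding weak_deriv_def using loc_int_continuous[OF contF] by blast
  then obtain w N3 where w: "\<And>a b. a \<le> b \<Longrightarrow> integral {a..b} F = w b - w a"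
    and N3: "negligible N3" "\<And>t. t \<notin> N3 \<Longrightarrow> V t = w t"
    using weak_deriv_imp_primitive[OF liV] by metis
  have dw: "(w has_real_derivative F t) (at t)" for t
    using primitive_has_real_derivative[OF contF w] .
  have contw: "continuous_on UNIV w"
    using dw by (meson DERIV_isCont continuous_at_imp_continuous_on)
  have contR: "continuous_on UNIV (\<lambda>t. (w t + c * p t) / D)"
    using D by (intro continuous_intros contw contp) auto
  \<comment> \<open>\<open>V = w\<close> almost everywhere, solved for \<open>v\<close>, has a
    continuous right-hand side.\<close>
  have "integral {x..y} (\<lambda>t. (w t + c * p t) / D) = U y - U x" if "x \<le> y" for x y
  proof -
    have "integral {x..y} (\<lambda>t. (w t + c * p t) / D) = integral {x..y} v"
    proof (rule integral_spike[OF negligible_Un[OF N(1) N3(1)]])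
      show "v t = (w t + c * p t) / D" if "t \<in> {x..y} - (N \<union> N3)" for t
        using that N(2)[of t] N3(2)[of t] D by (simp add: V_def field_simps)
    qed
    then show ?thesis using U[OF that] by simp
  qed
  then have "(U has_real_derivative (w t + c * p t) / D) (at t)" for t
    using primitive_has_real_derivative[OF contR] by blast
  then have du: "((\<lambda>t. p t powr m) has_real_derivative (w t + c * p t) / D) (at t)" for t
    using U_eq by (metis (no_types, lifting) ext)
  \<comment> \<open>On the left half-line p powr m is constant, so \<open>w + c p\<close> and
    therefore \<open>w\<close> vanish there; continuity then gives \<open>w 0 = 0\<close>.\<close>
  have "w t = 0" if "t < 0" for t
  proof -
    have "((\<lambda>_. 0) has_real_derivative 0) (at t)" by simp
    then have "((\<lambda>t. p t powr m) has_real_derivative 0) (at t)"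
      by (rule has_field_derivative_transform_within_open[where S = "{..<0}"]) (use that p0 in auto)
    then have "(w t + c * p t) / D = 0" using du DERIV_unique by blast
    then show ?thesis using D p0[of t] that by simp
  qed
  then have "w 0 = 0"
    by (rule continuous_eq_off_negligible[OF negligible_empty contw continuous_on_const open_lessThan[of 0]]) auto
  then show ?thesis
    using that[OF contp p_nonneg p0 N du] dw unfolding F_def by blast
qed

text \<open>The continuous representative of a positive function may have zeros, and these are
  excluded here. At a first zero \<open>t1\<close> the minimum of p powr m gives
  \<open>w t1 = 0\<close>. Then either w' > 0 on all of (0, t1), against \<open>w 0 = 0\<close>, or
  w' < 0 just before \<open>t1\<close>, which makes \<open>w\<close> positive there and p powr m
  increase to the value 0.\<close>

lemma wave_representative_pos:
  fixes p w b d :: "real \<Rightarrow> real"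
  assumes m: "m > 0" and D: "D > 0" and c: "c > 0" and r: "r \<ge> 0"
    and contp: "continuous_on UNIV p" and p_nonneg: "\<And>t. 0 \<le> p t" and p0: "\<And>t. t \<le> 0 \<Longrightarrow> p t = 0"
    and contb: "continuous_on {0..} b" and contd: "continuous_on {0..} d"
    and du: "\<And>t. ((\<lambda>t. p t powr m) has_real_derivative (w t + c * p t) / D) (at t)"
    and dw: "\<And>t. (w has_real_derivative d (p t) - b (p (t - c * r))) (at t)" and w0: "w 0 = 0"
    and d0: "d 0 = 0" and b0: "b 0 = 0"
    and d_pos: "\<And>s. s > 0 \<Longrightarrow> d s > 0" and b_pos: "\<And>s. s > 0 \<Longrightarrow> b s > 0"
    and \<kappa>: "\<kappa> > 0" and bd: "\<And>s. 0 < s \<Longrightarrow> s < \<kappa> \<Longrightarrow> d s < b s"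
    and \<delta>: "\<delta> > 0" and pos: "\<And>t. 0 < t \<Longrightarrow> t < \<delta> \<Longrightarrow> p t > 0" and t: "t > 0"
  shows "p t > 0"
proof (rule ccontr)
  assume "\<not> p t > 0"
  then have pt: "p t = 0" using p_nonneg[of t] by linarith
  then have "t \<ge> \<delta>" using pos[of t] t by force
  \<comment> \<open>Positive zeros are at least \<delta>, so the first one is the minimum of a
    compact set.\<close>
  define Z where "Z = {\<delta>..t} \<inter> p -` {0}"
  have "compact Z"
    unfolding Z_def using contp
    by (intro compact_Int_closed continuous_closed_vimage) (auto simp: continuous_on_eq_continuous_at)
  moreover have "t \<in> Z" using \<open>t \<ge> \<delta>\<close> pt by (simp add: Z_def)
  ultimately obtain t1 where t1: "t1 \<in> Z" "\<And>s. s \<in> Z \<Longrightarrow> t1 \<le> s"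
    using compact_attains_inf[of Z] by blast
  have t1_pos: "t1 > 0" and pt1: "p t1 = 0" using t1(1) \<delta> by (auto simp: Z_def)
  have before: "p s > 0" if "0 < s" "s < t1" for s
  proof (rule ccontr)
    assume "\<not> p s > 0"
    then have "p s = 0" using p_nonneg[of s] by linarith
    then have "s \<in> Z" using pos[of s] that t1(1) by (force simp: Z_def)
    then show False using t1(2) that by force
  qed
  have "(w t1 + c * p t1) / D = 0"
    by (rule DERIV_local_min[OF du zero_less_one]) (use pt1 m in auto)
  then have wt1: "w t1 = 0" using D pt1 by simp
  have contw: "continuous_on A w" for A
    using dw by (meson DERIV_isCont continuous_at_imp_continuous_on)
  show False
  proof (cases "r > 0 \<and> t1 \<le> c * r")
    case True
    have "w 0 < w t1"
    proof (rule DERIV_pos_imp_increasing_open[OF t1_pos])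
      show "\<exists>y. (w has_real_derivative y) (at s) \<and> 0 < y" if "0 < s" "s < t1" for s
      proof -
        \<comment> \<open>The delayed argument is nonpositive, so the birth term vanishes and w' =
          d(p) > 0.\<close>
        have "p (s - c * r) = 0" using p0 that True by simp
        then have "0 < d (p s) - b (p (s - c * r))"
          using d_pos[OF before[OF that]] b0 by simp
        then show ?thesis using dw by blast
      qed
    qed (rule contw)
    then show False using w0 wt1 by simp
  next
    case False
    \<comment> \<open>Without delay this is \<open>d < b\<close> at small positive values of
      \<open>p\<close>. With delay, d(p t1) = 0 lies below the positive birth term at
      \<open>t1 - c * r > 0\<close>, and continuity extends this to the left of
      \<open>t1\<close>.\<close>
    have "\<exists>e>0. e \<le> t1 \<and> (\<forall>s. t1 - e < s \<and> s < t1 \<longrightarrow> d (p s) - b (p (s - c * r)) < 0)"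
    proof (cases "r = 0")
      case True
      have "\<forall>\<^sub>F s in at t1. p s < \<kappa>"
      proof (rule order_tendstoD(2))
        show "(p \<longlongrightarrow> p t1) (at t1)"
          using contp by (simp add: continuous_on_eq_continuous_at isCont_def)
      qed (use pt1 \<kappa> in simp)
      then obtain e where e: "e > 0" "\<And>s. s \<noteq> t1 \<Longrightarrow> dist s t1 < e \<Longrightarrow> p s < \<kappa>"
        by (auto simp: eventually_at)
      show ?thesis
      proof (rule exI[of _ "min e t1"], intro conjI allI impI)
        fix s assume "t1 - min e t1 < s \<and> s < t1"
        then have s: "0 < s" "s < t1" "dist s t1 < e" by (auto simp: dist_real_def)
        then show "d (p s) - b (p (s - c * r)) < 0"
          using bd[OF before e(2)] True by simp
      qed (use e t1_pos in auto)
    next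
      case r_nz: False
      then have "t1 - c * r > 0" "t1 - c * r < t1" using False r c by auto
      then have neg: "d (p t1) - b (p (t1 - c * r)) < 0"
        using b_pos[OF before] pt1 d0 by simp
      have "continuous_on UNIV (\<lambda>t. d (p t))"
        by (rule continuous_on_compose2[OF contd contp]) (use p_nonneg in auto)
      moreover have "continuous_on UNIV (\<lambda>t. b (p (t - c * r)))"
        by (rule continuous_on_compose2[OF contb continuous_on_compose2[OF contp]])
           (use p_nonneg in \<open>auto intro!: continuous_intros\<close>)
      ultimately have "continuous_on UNIV (\<lambda>s. d (p s) - b (p (s - c * r)))"
        by (rule continuous_on_diff)
      then have "\<forall>\<^sub>F s in at t1. d (p s) - b (p (s - c * r)) < 0"
        using neg by (intro order_tendstoD(2)[OF _ neg]) (auto simp: continuous_on_eq_continuous_at isCont_def)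
      then obtain e where e: "e > 0" "\<And>s. s \<noteq> t1 \<Longrightarrow> dist s t1 < e \<Longrightarrow> d (p s) - b (p (s - c * r)) < 0"
        by (auto simp: eventually_at)
      show ?thesis
      proof (rule exI[of _ "min e t1"], intro conjI allI impI)
        fix s assume "t1 - min e t1 < s \<and> s < t1"
        then show "d (p s) - b (p (s - c * r)) < 0"
          by (intro e(2)) (auto simp: dist_real_def)
      qed (use e t1_pos in auto)
    qed
    then obtain e where e: "e > 0" "e \<le> t1" "\<And>s. t1 - e < s \<Longrightarrow> s < t1 \<Longrightarrow> d (p s) - b (p (s - c * r)) < 0"
      by blast
    have w_pos: "w s > 0" if s: "t1 - e < s" "s < t1" for s
    proof -
      have "w t1 < w s"
      proof (rule DERIV_neg_imp_decreasing_open[OF s(2)])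
        show "\<exists>y. (w has_real_derivative y) (at x) \<and> y < 0" if "s < x" "x < t1" for x
          using dw[of x] e(3)[of x] that s by force
      qed (rule contw)
      then show ?thesis using wt1 by simp
    qed
    have "p (t1 - e / 2) powr m < p t1 powr m"
    proof (rule DERIV_pos_imp_increasing_open[where f = "\<lambda>t. p t powr m"])
      show "\<exists>y. ((\<lambda>t. p t powr m) has_real_derivative y) (at x) \<and> 0 < y" if "t1 - e / 2 < x" "x < t1" for x
      proof -
        have "w x + c * p x > 0"
          using w_pos[of x] p_nonneg[of x] c that e(1) by (intro add_pos_nonneg) auto
        then show ?thesis using du[of x] D by (intro exI[of _ "(w x + c * p x) / D"]) simp
      qed
      show "continuous_on {t1 - e / 2..t1} (\<lambda>t. p t powr m)"
        using du by (meson DERIV_isCont continuous_at_imp_continuous_on)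
    qed (use e in simp)
    then show False using pt1 by simp
  qed
qed

section \<open>The second derivative for exponents below two\<close>

text \<open>The nonnegative function \<open>p powr (1 - m) * p'\<close> is integrable at \<open>0\<close>, being a multiple of
  the derivative of the continuous function \<open>p powr (2 - m)\<close>; together with
  \<open>p powr (2 - m)\<close> it dominates \<open>p''\<close>.\<close>
lemma wave_representative_second_deriv:
  fixes p w F :: "real \<Rightarrow> real"
  assumes m: "1 < m" "m < 2" and D: "D > 0" and c: "c > 0" and K: "K > 0" and \<delta>: "\<delta> > 0"
    and contp: "continuous_on UNIV p" and p0: "\<And>t. t \<le> 0 \<Longrightarrow> p t = 0" and pos: "\<And>t. t > 0 \<Longrightarrow> p t > 0"
    and du: "\<And>t. ((\<lambda>t. p t powr m) has_real_derivative (w t + c * p t) / D) (at t)"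
    and dw: "\<And>t. (w has_real_derivative F t) (at t)" and w0: "w 0 = 0" and contF: "continuous_on UNIV F"
    and mono: "\<And>s t. 0 < s \<Longrightarrow> s \<le> t \<Longrightarrow> t < \<delta> \<Longrightarrow> p s \<le> p t"
    and bound: "\<And>t. 0 < t \<Longrightarrow> t < \<delta> \<Longrightarrow> \<bar>F t\<bar> \<le> K * p t"
  shows "second_deriv_L1loc p"
proof -
  \<comment> \<open>Solving m p powr (m - 1) p' = (w + c p) / D for p' gives \<open>k\<close>;
    \<open>h\<close> is its derivative by the product rule. Both are set to 0 on the left
    half-line.\<close>
  define k where "k t = (if t > 0 then (w t + c * p t) * p t powr (1 - m) / (D * m) else 0)" for t
  define h where "h t = (if t > 0 then ((F t + c * k t) * p t powr (1 - m) +
      (w t + c * p t) * ((1 - m) * p t powr (- m) * k t)) / (D * m) else 0)" for t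
  have dp: "(p has_real_derivative k t) (at t)" if "t > 0" for t
  proof -
    have pt: "p t powr m > 0" using pos[OF that] by simp
    \<comment> \<open>Differentiability is known for p powr m only, so \<open>p\<close> is recovered
      as its power 1 / m, which is smooth at positive values.\<close>
    have "((\<lambda>t. (p t powr m) powr (1 / m)) has_real_derivative
        (1 / m) * (p t powr m) powr (1 / m - 1) * ((w t + c * p t) / D)) (at t)"
      by (rule DERIV_chain2[where f = "\<lambda>u. u powr (1 / m)", OF has_real_derivative_powr[OF pt] du])
    moreover have "(p t powr m) powr (1 / m - 1) = p t powr (1 - m)"
      using m by (simp add: powr_powr right_diff_distrib)
    ultimately have "((\<lambda>t. (p t powr m) powr (1 / m)) has_real_derivative k t) (at t)"
      using that by (simp add: k_def mult_ac)
    then show ?thesis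
      by (rule has_field_derivative_transform_within_open[where S = "{0<..}"])
         (use that pos m in \<open>auto simp: powr_powr less_imp_le\<close>)
  qed
  have dpowr: "((\<lambda>t. p t powr a) has_real_derivative a * p t powr (a - 1) * k t) (at t)" if "t > 0" for t a
    by (rule DERIV_chain2[where f = "\<lambda>u. u powr a", OF has_real_derivative_powr[OF pos[OF that]] dp[OF that]])
  have dk: "(k has_real_derivative h t) (at t)" if "t > 0" for t
  proof -
    have "((\<lambda>t. (w t + c * p t) * p t powr (1 - m) / (D * m)) has_real_derivative
       ((F t + c * k t) * p t powr (1 - m) + ((1 - m) * p t powr (1 - m - 1) * k t) * (w t + c * p t)) / (D * m)) (at t)"
      by (intro DERIV_cdivide DERIV_mult DERIV_add dw DERIV_cmult dp dpowr that)
    then have "((\<lambda>t. (w t + c * p t) * p t powr (1 - m) / (D * m)) has_real_derivative h t) (at t)"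
      using that by (simp add: h_def mult_ac)
    then show ?thesis
      by (rule has_field_derivative_transform_within_open[where S = "{0<..}"]) (use that in \<open>auto simp: k_def\<close>)
  qed
  \<comment> \<open>\<open>\<delta> / 2\<close> keeps the closed interval within the range of the
    bounds, and \<open>e * K \<le> c\<close> turns |w| \<le> t K p into |w| \<le> c p.\<close>
  define e where "e = min (\<delta> / 2) (c / K)"
  have e: "e > 0" "e < \<delta>" "e * K \<le> c"
    using \<delta> c K by (auto simp: e_def min_def field_simps)
  \<comment> \<open>Mean value theorem from \<open>w 0 = 0\<close>; monotonicity replaces the
    intermediate \<open>p z\<close> by \<open>p t\<close>.\<close>
  have w_bound: "\<bar>w t\<bar> \<le> c * p t" if t: "0 < t" "t \<le> e" for t
  proof -
    obtain z where z: "0 < z" "z < t" "w t - w 0 = (t - 0) * F z"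
      using MVT2[OF t(1), of w F] dw by blast
    have "\<bar>w t\<bar> = t * \<bar>F z\<bar>" using z w0 t by (simp add: abs_mult)
    also have "\<dots> \<le> t * (K * p z)"
      using bound[of z] z t e by (intro mult_left_mono) auto
    also have "\<dots> \<le> e * (K * p t)"
      using mono[of z t] z t e K pos[of z] by (intro mult_mono) auto
    also have "\<dots> \<le> c * p t"
      using mult_right_mono[OF e(3), of "p t"] pos[OF t(1)] by (simp add: mult_ac)
    finally show ?thesis .
  qed
  have k_nonneg: "k t \<ge> 0" if t: "0 < t" "t \<le> e" for t
  proof -
    have "w t + c * p t \<ge> 0" using w_bound[OF t] by linarith
    then show ?thesis using t D m by (simp add: k_def)
  qed
  have p_nonneg: "p t \<ge> 0" for t
    using p0[of t] pos[of t] by (cases "t > 0") auto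
  have contG: "continuous_on UNIV (\<lambda>t. p t powr (2 - m))"
    by (intro continuous_on_powr' contp continuous_on_const) (use p_nonneg m in auto)
  have k_bound: "\<bar>k t\<bar> \<le> 2 * c / (D * m) * p t powr (2 - m)" if t: "t \<le> e" for t
  proof (cases "t > 0")
    case True
    have "w t + c * p t \<le> 2 * c * p t" using w_bound[OF True t] by linarith
    then have "(w t + c * p t) * p t powr (1 - m) \<le> 2 * c * p t * p t powr (1 - m)"
      by (rule mult_right_mono) simp
    also have "\<dots> = 2 * c * p t powr (2 - m)"
    proof -
      have "p t * p t powr (1 - m) = p t powr (2 - m)"
        using powr_mult_base[of "p t" "1 - m"] pos[OF True] by simp
      then show ?thesis by (simp add: mult.assoc)
    qed
    finally have "k t \<le> 2 * c * p t powr (2 - m) / (D * m)"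
      using True D m by (simp add: k_def divide_right_mono)
    then show ?thesis using k_nonneg[OF True t] by simp
  next
    case False
    then show ?thesis using c D m by (simp add: k_def)
  qed
  have contk: "continuous_on UNIV k"
  proof (rule continuous_at_imp_continuous_on, rule ballI)
    fix t :: real
    consider "t < 0" | "t = 0" | "t > 0" by linarith
    then show "isCont k t"
    proof cases
      case 1
      have "((\<lambda>_. 0) has_real_derivative 0) (at t)" by simp
      then have "(k has_real_derivative 0) (at t)"
        by (rule has_field_derivative_transform_within_open[where S = "{..<0}"]) (use 1 in \<open>auto simp: k_def\<close>)
      then show ?thesis by (rule DERIV_isCont)
    next
      case 2
      \<comment> \<open>At 0, \<open>k\<close> is squeezed by a multiple of p powr (2 - m), which
        tends to 0 because m < 2.\<close>
      have "isCont (\<lambda>t. p t powr (2 - m)) 0"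
        using contG by (simp add: continuous_on_eq_continuous_at)
      then have "((\<lambda>t. 2 * c / (D * m) * p t powr (2 - m)) \<longlongrightarrow> 2 * c / (D * m) * p 0 powr (2 - m)) (at 0)"
        unfolding isCont_def by (intro tendsto_mult tendsto_const)
      then have "((\<lambda>t. 2 * c / (D * m) * p t powr (2 - m)) \<longlongrightarrow> 0) (at 0)"
        using p0[of 0] by simp
      moreover have "\<forall>\<^sub>F t in at 0. norm (k t) \<le> 2 * c / (D * m) * p t powr (2 - m)"
        using e(1) k_bound by (auto simp: eventually_at dist_real_def intro!: exI[of _ e])
      ultimately have "(k \<longlongrightarrow> 0) (at 0)"
        by (rule Lim_null_comparison[rotated])
      then show ?thesis using 2 by (simp add: isCont_def k_def)
    next
      case 3
      then show ?thesis using dk DERIV_isCont by blast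
    qed
  qed
  \<comment> \<open>The first term is arranged so that (2 - m) p powr (1 - m) k is exactly the
    derivative of p powr (2 - m) for t > 0; the divisor 2 - m compensates.\<close>
  have h_bound: "\<bar>h t\<bar> \<le> (c + 2 * c * (m - 1)) / (D * m * (2 - m)) * ((2 - m) * p t powr (1 - m) * k t)
      + K / (D * m) * p t powr (2 - m)" if t: "0 \<le> t" "t \<le> e" for t
  proof (cases "t > 0")
    case True
    define s where "s = p t"
    have s: "s > 0" using pos[OF True] by (simp add: s_def)
    have pw: "s * s powr (1 - m) = s powr (2 - m)" "s * s powr (- m) = s powr (1 - m)"
      using powr_mult_base[of s "1 - m"] powr_mult_base[of s "- m"] s by auto
    have F: "\<bar>F t\<bar> \<le> K * s" using bound[of t] True t e by (simp add: s_def)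
    have w: "\<bar>w t + c * s\<bar> \<le> 2 * c * s" using w_bound[OF True t(2)] by (simp add: s_def)
    have k: "k t \<ge> 0" using k_nonneg True t by blast
    have "\<bar>(F t + c * k t) * s powr (1 - m)\<bar> \<le> (K * s + c * k t) * s powr (1 - m)"
    proof -
      have "0 \<le> c * k t" using k c by simp
      then have "\<bar>F t + c * k t\<bar> \<le> K * s + c * k t" using F by linarith
      then show ?thesis by (simp add: abs_mult mult_right_mono)
    qed
    moreover have "\<bar>(w t + c * s) * ((1 - m) * s powr (- m) * k t)\<bar> \<le> 2 * c * s * ((m - 1) * s powr (- m) * k t)"
    proof -
      have "\<bar>(1 - m) * s powr (- m) * k t\<bar> = (m - 1) * s powr (- m) * k t"
        using m k by (simp add: abs_mult)
      moreover have "\<bar>w t + c * s\<bar> * ((m - 1) * s powr (- m) * k t) \<le> 2 * c * s * ((m - 1) * s powr (- m) * k t)"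
        by (rule mult_right_mono[OF w]) (use m k in simp)
      ultimately show ?thesis
        by (simp only: abs_mult[of "w t + c * s"])
    qed
    ultimately have "\<bar>(F t + c * k t) * s powr (1 - m) + (w t + c * s) * ((1 - m) * s powr (- m) * k t)\<bar>
        \<le> (K * s + c * k t) * s powr (1 - m) + 2 * c * s * ((m - 1) * s powr (- m) * k t)"
      by linarith
    also have "\<dots> = K * (s * s powr (1 - m)) + c * k t * s powr (1 - m) + 2 * c * (m - 1) * (s * s powr (- m)) * k t"
      by (simp add: algebra_simps)
    also have "\<dots> = K * s powr (2 - m) + (c + 2 * c * (m - 1)) * (s powr (1 - m) * k t)"
      unfolding pw by (simp add: algebra_simps)
    finally have "\<bar>h t\<bar> \<le> (K * s powr (2 - m) + (c + 2 * c * (m - 1)) * (s powr (1 - m) * k t)) / (D * m)"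
      using True D m by (simp add: h_def abs_divide abs_mult divide_right_mono flip: s_def)
    also have "\<dots> = (c + 2 * c * (m - 1)) / (D * m * (2 - m)) * ((2 - m) * s powr (1 - m) * k t)
      + K / (D * m) * s powr (2 - m)"
    proof -
      have aux: "(K * X + Y * (Z * u)) / E = Y / (E * n) * (n * Z * u) + K / E * X"
        if "E \<noteq> 0" "n \<noteq> 0" for X Y Z u E n :: real
        using that by (simp add: field_simps)
      show ?thesis by (rule aux) (use D m in auto)
    qed
    finally show ?thesis by (simp add: s_def)
  next
    case False
    then have "t = 0" using t by simp
    then show ?thesis using p0[of 0] by (simp add: h_def)
  qed
  \<comment> \<open>Integrability of \<open>h\<close> itself comes from its primitive
    \<open>k\<close>, continuous up to 0; the majorant upgrades it to absolute
    integrability.\<close>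
  have h_near: "h absolutely_integrable_on {0..e}"
  proof (rule absolutely_integrable_integrable_bound[OF h_bound[unfolded real_norm_def[symmetric]]])
    show "h integrable_on {0..e}"
      using fundamental_theorem_of_calculus_interior[of 0 e k h] e(1) dk continuous_on_subset[OF contk]
      by (auto simp: has_real_derivative_iff_has_vector_derivative integrable_on_def)
    have "((\<lambda>t. (2 - m) * p t powr (1 - m) * k t) has_integral p e powr (2 - m) - p 0 powr (2 - m)) {0..e}"
    proof (rule fundamental_theorem_of_calculus_interior)
      show "((\<lambda>t. p t powr (2 - m)) has_vector_derivative (2 - m) * p t powr (1 - m) * k t) (at t)"
        if "t \<in> {0<..<e}" for t
        using dpowr[of t "2 - m"] that by (simp add: has_real_derivative_iff_has_vector_derivative)
    qed (use e continuous_on_subset[OF contG] in auto)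
    moreover have "(\<lambda>t. p t powr (2 - m)) integrable_on {0..e}"
      using continuous_on_subset[OF contG] integrable_continuous_real by blast
    ultimately show "(\<lambda>t. (c + 2 * c * (m - 1)) / (D * m * (2 - m)) * ((2 - m) * p t powr (1 - m) * k t)
      + K / (D * m) * p t powr (2 - m)) integrable_on {0..e}"
      by (intro integrable_add integrable_on_mult_right) auto
  qed auto
  \<comment> \<open>On \<open>{e..T}\<close> the function \<open>p\<close> does not vanish, so its
    negative powers are continuous.\<close>
  have h_far: "h absolutely_integrable_on {e..T}" for T
  proof -
    have contw: "continuous_on UNIV w"
      using dw by (meson DERIV_isCont continuous_at_imp_continuous_on)
    have pw: "continuous_on {e..T} (\<lambda>t. p t powr a)" for a
      by (intro continuous_on_powr continuous_on_subset[OF contp] continuous_on_const)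
         (use pos[THEN less_imp_neq] e in auto)
    have "continuous_on {e..T} (\<lambda>t. ((F t + c * k t) * p t powr (1 - m) +
      (w t + c * p t) * ((1 - m) * p t powr (- m) * k t)) / (D * m))"
      by (intro continuous_on_divide continuous_on_add continuous_on_mult continuous_on_const pw
          continuous_on_subset[OF contp] continuous_on_subset[OF contw] continuous_on_subset[OF contk]
          continuous_on_subset[OF contF] subset_UNIV) (use D m in auto)
    then have "continuous_on {e..T} h"
      by (rule continuous_on_eq) (use e in \<open>auto simp: h_def\<close>)
    then show ?thesis by (rule absolutely_integrable_continuous_real)
  qed
  have h_left: "h absolutely_integrable_on {a..0}" for a
    by (rule absolutely_integrable_spike[where f = "\<lambda>_. 0", OF _ negligible_empty])
       (auto simp: h_def absolutely_integrable_on_def)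
  have li_h: "loc_int h"
    unfolding loc_int_def
  proof (intro allI)
    fix a b
    have "h absolutely_integrable_on ({a..0} \<union> {0..e} \<union> {e..b})"
      using h_left h_near h_far by (intro absolutely_integrable_Un) auto
    then show "h absolutely_integrable_on {a..b}"
      by (rule set_integrable_subset) auto
  qed
  have dp': "(p has_real_derivative k t) (at t)" and dk': "(k has_real_derivative h t) (at t)" if "t \<noteq> 0" for t
  proof -
    have "(p has_real_derivative k t) (at t) \<and> (k has_real_derivative h t) (at t)"
    proof (cases "t > 0")
      case True
      then show ?thesis using dp dk by blast
    next
      case False
      have "((\<lambda>_. 0) has_real_derivative 0) (at t)" by simp
      then have "(p has_real_derivative 0) (at t)" "(k has_real_derivative 0) (at t)"
        by (rule has_field_derivative_transform_within_open[where S = "{..<0}"];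
            use that False p0 in \<open>auto simp: k_def\<close>)+
      then show ?thesis using False by (simp add: k_def h_def)
    qed
    then show "(p has_real_derivative k t) (at t)" "(k has_real_derivative h t) (at t)" by auto
  qed
  have "integral UNIV (\<lambda>x. p x * deriv (deriv \<psi>) x) = integral UNIV (\<lambda>x. h x * \<psi> x)"
    if \<psi>: "test_fun \<psi>" for \<psi>
  proof -
    obtain x y where xy: "\<And>t. t \<notin> {x..y} \<Longrightarrow> \<psi> t = 0"
      using \<psi> unfolding test_fun_def by blast
    obtain x' y' where xy': "\<And>t. t \<notin> {x'..y'} \<Longrightarrow> deriv \<psi> t = 0"
      using test_fun_deriv[OF \<psi>] unfolding test_fun_def by blast
    obtain x'' y'' where xy'': "\<And>t. t \<notin> {x''..y''} \<Longrightarrow> deriv (deriv \<psi>) t = 0"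
      using test_fun_deriv[OF test_fun_deriv[OF \<psi>]] unfolding test_fun_def by blast
    \<comment> \<open>Including 0 and moving out by 1 gives A < 0 < B, even for empty supports, and
      puts both ends off the supports.\<close>
    define A where "A = min (min x x') (min x'' 0) - 1"
    define B where "B = max (max y y') (max y'' 0) + 1"
    have supp: "\<psi> t = 0 \<and> deriv \<psi> t = 0 \<and> deriv (deriv \<psi>) t = 0" if "t \<notin> {A<..<B}" for t
    proof -
      have "t \<notin> {x..y}" "t \<notin> {x'..y'}" "t \<notin> {x''..y''}"
        using that by (auto simp: A_def B_def)
      then show ?thesis using xy xy' xy'' by blast
    qed
    \<comment> \<open>One antiderivative performs both integrations by parts, the mixed terms
      \<open>k t * deriv \<psi> t\<close> cancelling. At the exceptional point 0 continuity of
      \<open>p\<close> and \<open>k\<close> suffices.\<close>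
    have "((\<lambda>t. p t * deriv (deriv \<psi>) t - h t * \<psi> t) has_integral
        (p B * deriv \<psi> B - k B * \<psi> B) - (p A * deriv \<psi> A - k A * \<psi> A)) {A..B}"
    proof (rule fundamental_theorem_of_calculus_interior_strong[of "{0}"])
      show "A \<le> B" by (simp add: A_def B_def)
      show "continuous_on {A..B} (\<lambda>t. p t * deriv \<psi> t - k t * \<psi> t)"
        by (intro continuous_on_diff continuous_on_mult test_fun_continuous \<psi> test_fun_deriv
            continuous_on_subset[OF contp] continuous_on_subset[OF contk] subset_UNIV)
      fix t assume "t \<in> {A<..<B} - {0}"
      then have "t \<noteq> 0" by simp
      have "((\<lambda>t. p t * deriv \<psi> t - k t * \<psi> t) has_real_derivative
          (k t * deriv \<psi> t + deriv (deriv \<psi>) t * p t) - (h t * \<psi> t + deriv \<psi> t * k t)) (at t)"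
        by (intro DERIV_diff DERIV_mult dp' dk' \<open>t \<noteq> 0\<close> test_fun_has_derivative test_fun_deriv \<psi>)
      then show "((\<lambda>t. p t * deriv \<psi> t - k t * \<psi> t) has_vector_derivative
          p t * deriv (deriv \<psi>) t - h t * \<psi> t) (at t)"
        by (simp add: has_real_derivative_iff_has_vector_derivative algebra_simps)
    qed simp
    then have "integral {A..B} (\<lambda>t. p t * deriv (deriv \<psi>) t - h t * \<psi> t) = 0"
      using supp[of A] supp[of B] by (simp add: integral_unique)
    then have "integral UNIV (\<lambda>t. p t * deriv (deriv \<psi>) t - h t * \<psi> t) = 0"
      by (subst integral_supported[of A B]) (use supp in auto)
    moreover have "integral UNIV (\<lambda>t. p t * deriv (deriv \<psi>) t - h t * \<psi> t) =
        integral UNIV (\<lambda>t. p t * deriv (deriv \<psi>) t) - integral UNIV (\<lambda>t. h t * \<psi> t)"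
      by (intro Henstock_Kurzweil_Integration.integral_diff loc_int_mult_test_fun loc_int_continuous
          contp li_h test_fun_deriv \<psi>)
    ultimately show ?thesis by simp
  qed
  then show ?thesis
    unfolding second_deriv_L1loc_def using li_h by blast
qed

section \<open>Transfer between a function and its continuous representative\<close>

text \<open>The inequality holds off \<open>N\<close> and is extended one argument at a time, first
  the left, then the right; the midpoint \<open>q\<close> keeps the two in order during the
  approach.\<close>

lemma mono_on_continuous_representative:
  fixes f p :: "real \<Rightarrow> real"
  assumes mono: "mono_on {..<\<delta>} f" and contp: "continuous_on UNIV p"
    and N: "negligible N" "\<And>t. t \<notin> N \<Longrightarrow> f t = p t"
  shows "mono_on {..<\<delta>} p"
proof (rule mono_onI)
  fix s t assume st: "s \<in> {..<\<delta>}" "t \<in> {..<\<delta>}" "s \<le> t"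
  show "p s \<le> p t"
  proof (cases "s = t")
    case False
    define q where "q = (s + t) / 2"
    have q: "s < q" "q < t" using False st by (auto simp: q_def)
    have *: "p s \<le> p y" if y: "q < y" "y < \<delta>" "y \<notin> N" for y
    proof -
      have "max (p s) (p y) = p y"
      proof (rule continuous_eq_off_negligible[OF N(1) _ continuous_on_const open_lessThan[of q],
            where f = "\<lambda>x. max (p x) (p y)" and x = s])
        show "continuous_on UNIV (\<lambda>x. max (p x) (p y))" by (intro continuous_intros contp)
        show "max (p x) (p y) = p y" if "x \<in> {..<q}" "x \<notin> N" for x
          using mono_onD[OF mono, of x y] that y N(2)[of x] N(2)[of y] by simp
      qed (use q in simp)
      then show ?thesis by linarith
    qed
    have "max (p s) (p t) = p t"
    proof (rule continuous_eq_off_negligible[OF N(1) _ contp open_greaterThanLessThan[of q \<delta>],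
          where f = "\<lambda>x. max (p s) (p x)"])
      show "continuous_on UNIV (\<lambda>x. max (p s) (p x))" by (intro continuous_intros contp)
      show "max (p s) (p x) = p x" if "x \<in> {q<..<\<delta>}" "x \<notin> N" for x
        using *[of x] that by simp
      show "t \<in> closure {q<..<\<delta>}"
        using closure_subset q st by fastforce
    qed
    then show ?thesis by linarith
  qed simp
qed

lemma second_deriv_L1loc_cong:
  assumes sd: "second_deriv_L1loc p" and N: "negligible N" "\<And>t. t \<notin> N \<Longrightarrow> f t = p t"
  shows "second_deriv_L1loc f"
proof -
  have "integral UNIV (\<lambda>x. f x * deriv (deriv \<psi>) x) = integral UNIV (\<lambda>x. p x * deriv (deriv \<psi>) x)" for \<psi>
    by (rule integral_spike[OF N(1)]) (use N(2) in auto)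
  then show ?thesis
    using sd unfolding second_deriv_L1loc_def by simp
qed

section \<open>The two ranges of the exponent\<close>

theorem theorem2p4:
  fixes m D r c \<kappa> sM \<zeta>1 \<zeta>2 :: real
    and b d b' d' d'' \<phi> :: "real \<Rightarrow> real"
  assumes m: "m > 1" and D: "D > 0" and r: "r \<ge> 0"
    (* d \<in> C^2([0,+oo)), d(0) = 0, d' > 0, d'' \<ge> 0 on (0,+oo) *)
    and d_der: "\<And>s. s \<ge> 0 \<Longrightarrow> (d has_real_derivative d' s) (at s within {0..})"
    and d'_der: "\<And>s. s \<ge> 0 \<Longrightarrow> (d' has_real_derivative d'' s) (at s within {0..})"
    and d''_cont: "continuous_on {0..} d''"
    and d0: "d 0 = 0"
    and d'_pos: "\<And>s. s > 0 \<Longrightarrow> d' s > 0"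
    and d''_nonneg: "\<And>s. s > 0 \<Longrightarrow> d'' s \<ge> 0"
    (* b \<in> C^1([0,+oo);[0,+oo)) *)
    and b_der: "\<And>s. s \<ge> 0 \<Longrightarrow> (b has_real_derivative b' s) (at s within {0..})"
    and b'_cont: "continuous_on {0..} b'"
    and b_nonneg: "\<And>s. s \<ge> 0 \<Longrightarrow> b s \<ge> 0"
    (* s_M: the unique positive local extremum point of b, its global maximum point *)
    and sM_unique: "\<And>s. pos_local_extremum b s \<longleftrightarrow> s = sM"
    and sM_max: "\<And>s. s \<ge> 0 \<Longrightarrow> b s \<le> b sM"
    and b0: "b 0 = 0"
    and kappa: "\<kappa> > 0" "b \<kappa> = d \<kappa>"
    and b'0: "b' 0 > d' 0"
    and b'kappa: "b' \<kappa> < d' \<kappa>"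
    and bd_between: "\<And>s. 0 < s \<Longrightarrow> s < \<kappa> \<Longrightarrow> d s < b s \<and> b s \<le> b' 0 * s"
    and sM_kappa: "sM < \<kappa>"
    (* \<zeta>2 = d^{-1}(M), M = b(s_M); \<zeta>1 \<in> (0,s_M) with b(\<zeta>1) = \<theta> = b(\<zeta>2) *)
    and zeta2: "\<zeta>2 \<ge> 0" "d \<zeta>2 = b sM"
    and zeta1: "0 < \<zeta>1" "\<zeta>1 < sM" "b \<zeta>1 = b \<zeta>2"
    (* \<phi> is a sharp wave of speed c as given by the existence result *)
    and c: "c > 0"
    and sharp: "sharp_wave m D r b d \<kappa> c \<phi>"
    and zero_left: "\<And>t. t \<le> 0 \<Longrightarrow> \<phi> t = 0"
    and pos_right: "\<And>t. t > 0 \<Longrightarrow> \<phi> t > 0"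
    and liminf_bd: "ereal \<zeta>1 \<le> Liminf at_top (\<lambda>t. ereal (\<phi> t))"
    and limsup_bd: "Limsup at_top (\<lambda>t. ereal (\<phi> t)) \<le> ereal \<zeta>2"
    and asym: "\<exists>\<Lambda> C1 C2. \<Lambda> > 1 / (m - 1) \<and> C1 > 0 \<and> C2 > 0 \<and>
                 (\<forall>t. 0 < t \<and> t < 1 \<longrightarrow>
                    \<bar>\<phi> t - C1 * t powr (1 / (m - 1))\<bar> \<le> C2 * t powr \<Lambda>)"
  shows "(m \<ge> 2 \<longrightarrow> sharp_nonC1_type \<phi>) \<and> (m < 2 \<longrightarrow> sharp_C1_type \<phi>)"
proof -
  have semi: "semi_wavefront m D r b d \<kappa> c \<phi>" and is_sharp: "is_sharp \<phi>"
    using sharp unfolding sharp_wave_def wave_solution_def wavefront_def by blast+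
  then have W: "W11_loc \<phi>" and Wm: "W11_loc (\<lambda>t. \<phi> t powr m)" and eqn: "wave_eq_distr m D r b d c \<phi>"
    and nonneg: "\<And>t. 0 \<le> \<phi> t"
    and mono: "mono_on UNIV \<phi> \<or> (\<exists>t0. mono_on {..<t0} \<phi> \<and> \<not> (\<exists>t1>t0. mono_on {..<t1} \<phi>) \<and> \<phi> t0 > \<kappa>)"
    unfolding semi_wavefront_def by blast+
  obtain \<Lambda> C1 C2 where asym': "\<Lambda> > 1 / (m - 1)" "C1 > 0" "C2 > 0"
    "\<And>t. 0 < t \<Longrightarrow> t < 1 \<Longrightarrow> \<bar>\<phi> t - C1 * t powr (1 / (m - 1))\<bar> \<le> C2 * t powr \<Lambda>"
    using asym by blast
  have contb: "continuous_on {0..} b" and contd: "continuous_on {0..} d"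
    using b_der d_der by (auto intro!: DERIV_continuous_on)
  have d_pos: "d s > 0" if "s > 0" for s
  proof -
    have "d 0 < d s"
    proof (rule DERIV_pos_imp_increasing_open[OF that])
      show "\<exists>y. (d has_real_derivative y) (at x) \<and> 0 < y" if "0 < x" for x
        using d_der[of x] d'_pos[of x] that at_within_interior[of x "{0..}"] by auto
      show "continuous_on {0..s} d" by (rule continuous_on_subset[OF contd]) auto
    qed
    then show ?thesis using d0 by simp
  qed
  have b_pos: "b s > 0" if "s > 0" for s
  proof (cases "s \<le> \<kappa>")
    case True
    then show ?thesis
      using d_pos[OF that] bd_between[of s] that kappa(2) by (cases "s = \<kappa>") auto
  next
    case False
    \<comment> \<open>A zero of the nonnegative \<open>b\<close> beyond \<kappa> would be a minimum,
      hence a local extremum different from \<open>sM < \<kappa>\<close>.\<close>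
    have "b s \<noteq> 0"
    proof
      assume "b s = 0"
      then have "pos_local_extremum b s"
        unfolding pos_local_extremum_def using that b_nonneg
        by (intro conjI exI[of _ 1] disjI2) simp_all
      then have "s = sM" using sM_unique[of s] by blast
      then show False using sM_kappa False by simp
    qed
    then show ?thesis using b_nonneg[of s] that by simp
  qed
  \<comment> \<open>The profile exponent 1 / (m - 1) is at most 1 precisely for m \<ge> 2.\<close>
  have "sharp_nonC1_type \<phi>" if "m \<ge> 2"
    unfolding sharp_nonC1_type_def
    using is_sharp sharp_corner_not_second_deriv_L1loc[OF W zero_left _ asym'] that by simp
  moreover have "sharp_C1_type \<phi>" if "m < 2"
  proof -
    have "m > 0" using m by simp
    obtain p w N where contp: "continuous_on UNIV p" and p_nonneg: "\<And>t. 0 \<le> p t"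
      and p0: "\<And>t. t \<le> 0 \<Longrightarrow> p t = 0" and N: "negligible N" "\<And>t. t \<notin> N \<Longrightarrow> \<phi> t = p t"
      and du: "\<And>t. ((\<lambda>t. p t powr m) has_real_derivative (w t + c * p t) / D) (at t)"
      and dw: "\<And>t. (w has_real_derivative d (p t) - b (p (t - c * r))) (at t)" and w0: "w 0 = 0"
      by (rule wave_regular_representative[OF \<open>m > 0\<close> D contb contd nonneg W Wm eqn zero_left], assumption) (rule that)
    \<comment> \<open>The interval of monotonicity extends past 0, since \<phi> t0 > \<kappa> > 0
      rules out \<open>t0 \<le> 0\<close>.\<close>
    obtain \<delta> where \<delta>: "\<delta> > 0" "mono_on {..<\<delta>} \<phi>"
    proof (cases "mono_on UNIV \<phi>")
      case True
      then show ?thesis using that[of 1] by (auto intro: mono_on_subset)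
    next
      case False
      then obtain t0 where t0: "mono_on {..<t0} \<phi>" "\<phi> t0 > \<kappa>" using mono by blast
      then have "t0 > 0" using zero_left[of t0] kappa(1) by force
      then show ?thesis using that t0 by blast
    qed
    have mono_p: "p s \<le> p t" if "s \<le> t" "t < \<delta>" for s t
      using mono_onD[OF mono_on_continuous_representative[OF \<delta>(2) contp N]] that by simp
    have pos: "p t > 0" if "t > 0" for t
    proof (rule wave_representative_pos[OF \<open>m > 0\<close> D c r contp p_nonneg p0 contb contd du dw w0 d0 b0
          d_pos b_pos kappa(1) _ \<delta>(1) _ that])
      show "d s < b s" if "0 < s" "s < \<kappa>" for s
        using bd_between that by blast
      \<comment> \<open>A point \<open>s < t\<close> off \<open>N\<close> has p s = \<phi> s > 0,
        and monotonicity passes this on to \<open>t\<close>.\<close>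
      show "p t > 0" if "0 < t" "t < \<delta>" for t
      proof -
        obtain s where "0 < s" "s < t" "s \<notin> N"
          using negligible_complement_interval[OF N(1) \<open>0 < t\<close>] by blast
        then show ?thesis
          using pos_right[of s] N(2)[of s] mono_p[of s t] that by simp
      qed
    qed
    \<comment> \<open>Close to 0 the values of \<open>p\<close> stay below \<kappa>, where d(s) <
      b(s) \<le> b'(0) s is available for s > 0.\<close>
    have "(p \<longlongrightarrow> p 0) (at 0)"
      using contp by (simp add: continuous_on_eq_continuous_at isCont_def)
    then have "\<forall>\<^sub>F t in at 0. p t < \<kappa>"
      by (rule order_tendstoD(2)) (use p0[of 0] kappa(1) in simp)
    then obtain e where e: "e > 0" "\<And>t. t \<noteq> 0 \<Longrightarrow> dist t 0 < e \<Longrightarrow> p t < \<kappa>"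
      by (auto simp: eventually_at)
    have K: "b' 0 > 0"
    proof -
      have "0 < b' 0 * (\<kappa> / 2)"
        using bd_between[of "\<kappa> / 2"] d_pos[of "\<kappa> / 2"] kappa(1) by force
      then show ?thesis using kappa(1) by (simp add: zero_less_mult_iff)
    qed
    have "second_deriv_L1loc p"
    proof (rule wave_representative_second_deriv[OF m that D c K _ contp p0 pos du dw w0])
      show "min \<delta> e > 0" using \<delta>(1) e(1) by simp
      show "p s \<le> p t" if "s \<le> t" "t < min \<delta> e" for s t
        using mono_p that by simp
      show "continuous_on UNIV (\<lambda>t. d (p t) - b (p (t - c * r)))"
      proof (rule continuous_on_diff)
        show "continuous_on UNIV (\<lambda>t. d (p t))"
          by (rule continuous_on_compose2[OF contd contp]) (use p_nonneg in auto)
        show "continuous_on UNIV (\<lambda>t. b (p (t - c * r)))"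
          by (rule continuous_on_compose2[OF contb continuous_on_compose2[OF contp]])
             (use p_nonneg in \<open>auto intro!: continuous_intros\<close>)
      qed
      \<comment> \<open>Both terms are nonnegative and at most b'(0) p t, the delayed one because
        \<open>p\<close> increases, so their difference obeys the same bound.\<close>
      show "\<bar>d (p t) - b (p (t - c * r))\<bar> \<le> b' 0 * p t" if t: "0 < t" "t < min \<delta> e" for t
      proof -
        have pt: "0 < p t" "p t < \<kappa>" using pos e(2)[of t] t by (auto simp: dist_real_def)
        have delay: "p (t - c * r) \<le> p t"
          using mono_p[of "t - c * r" t] t c r by simp
        have "b (p (t - c * r)) \<le> b' 0 * p (t - c * r)"
          using bd_between[of "p (t - c * r)"] delay pt p_nonneg[of "t - c * r"] b0
          by (cases "p (t - c * r) = 0") auto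
        also have "\<dots> \<le> b' 0 * p t" using delay K by simp
        finally have "b (p (t - c * r)) \<le> b' 0 * p t" .
        moreover have "d (p t) \<le> b' 0 * p t" using bd_between[OF pt] by linarith
        moreover have "0 \<le> b (p (t - c * r))" "0 < d (p t)"
          using b_nonneg p_nonneg d_pos pt by auto
        ultimately show ?thesis by linarith
      qed
    qed
    then have "second_deriv_L1loc \<phi>"
      by (rule second_deriv_L1loc_cong[OF _ N(1)]) (rule N(2))
    then show ?thesis
      unfolding sharp_C1_type_def using is_sharp by blast
  qed
  ultimately show ?thesis by blast
qed

end
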